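(* Let $\mathscr{A}$ and $\mathscr{B}$ be abelian categories such that $\mathscr{A}$ has enough injectives, and let $F : \mathscr{A} \to \mathscr{B}$ be a half-exact additive covariant functor. Then the right cosatellite $C^1F$ of $F$ is (naturally isomorphic to) the image of the canonical natural transformation $\rho_F : F \to R^0F$.
   Context: $F$ is half-exact if for each short exact sequence $0 \to A' \to A \to A'' \to 0$ the sequence $F(A') \to F(A) \to F(A'')$ is exact. Images of natural transformations are computed componentwise. Right cosatellite: for each object $A$ of $\mathscr{A}$ choose an exact sequence $0 \to A \to I \overset{p}{\to} \Sigma A \to 0$ with $I$ injective, and set $C^1F(A) := \ker F(p)$; values on morphisms are defined by extending morphisms along these sequences. $R^0F$ and $\rho_F$: for an object $A$ choose an exact sequence $0 \to A \overset{\iota}{\to} I^0 \overset{\partial}{\to} I^1$ with $I^0, I^1$ injective; $R^0F(A) := \ker F(\partial)$, and $F(\iota)$ induces $\rho_F(A) : F(A) \to R^0F(A)$. *)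

theory Defs
  imports "HOL-Algebra.Group"
begin

record ('o, 'm) cat =
  Obj :: "'o set"
  Arr :: "'m set"
  Dom :: "'m \<Rightarrow> 'o"
  Cod :: "'m \<Rightarrow> 'o"
  Idn :: "'o \<Rightarrow> 'm"
  Comp :: "'m \<Rightarrow> 'm \<Rightarrow> 'm" (infixl "\<cdot>\<index>" 70)

definition Hom :: "('o, 'm, 'x) cat_scheme \<Rightarrow> 'o \<Rightarrow> 'o \<Rightarrow> 'm set" where
  "Hom C a b = {f \<in> Arr C. Dom C f = a \<and> Cod C f = b}"

locale category =
  fixes C :: "('o, 'm, 'x) cat_scheme" (structure)
  assumes dom_obj: "f \<in> Arr C \<Longrightarrow> Dom C f \<in> Obj C"
    and cod_obj: "f \<in> Arr C \<Longrightarrow> Cod C f \<in> Obj C"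
    and idn_hom: "a \<in> Obj C \<Longrightarrow> Idn C a \<in> Hom C a a"
    and comp_hom: "\<lbrakk>f \<in> Hom C a b; g \<in> Hom C b c\<rbrakk> \<Longrightarrow> g \<cdot> f \<in> Hom C a c"
    and comp_idn: "f \<in> Hom C a b \<Longrightarrow> f \<cdot> Idn C a = f"
    and idn_comp: "f \<in> Hom C a b \<Longrightarrow> Idn C b \<cdot> f = f"
    and comp_assoc: "\<lbrakk>f \<in> Hom C a b; g \<in> Hom C b c; h \<in> Hom C c d\<rbrakk>
      \<Longrightarrow> (h \<cdot> g) \<cdot> f = h \<cdot> (g \<cdot> f)"

definition is_mono :: "('o, 'm, 'x) cat_scheme \<Rightarrow> 'm \<Rightarrow> bool" where
  "is_mono C f \<longleftrightarrow> f \<in> Arr C \<and>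
    (\<forall>a. \<forall>g \<in> Hom C a (Dom C f). \<forall>h \<in> Hom C a (Dom C f).
      f \<cdot>\<^bsub>C\<^esub> g = f \<cdot>\<^bsub>C\<^esub> h \<longrightarrow> g = h)"

definition is_epi :: "('o, 'm, 'x) cat_scheme \<Rightarrow> 'm \<Rightarrow> bool" where
  "is_epi C f \<longleftrightarrow> f \<in> Arr C \<and>
    (\<forall>b. \<forall>g \<in> Hom C (Cod C f) b. \<forall>h \<in> Hom C (Cod C f) b.
      g \<cdot>\<^bsub>C\<^esub> f = h \<cdot>\<^bsub>C\<^esub> f \<longrightarrow> g = h)"

definition is_iso :: "('o, 'm, 'x) cat_scheme \<Rightarrow> 'm \<Rightarrow> bool" where
  "is_iso C f \<longleftrightarrow> f \<in> Arr C \<and>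
    (\<exists>g \<in> Hom C (Cod C f) (Dom C f).
      g \<cdot>\<^bsub>C\<^esub> f = Idn C (Dom C f) \<and> f \<cdot>\<^bsub>C\<^esub> g = Idn C (Cod C f))"

definition is_zero_object :: "('o, 'm, 'x) cat_scheme \<Rightarrow> 'o \<Rightarrow> bool" where
  "is_zero_object C z \<longleftrightarrow> z \<in> Obj C \<and>
    (\<forall>a \<in> Obj C. (\<exists>!f. f \<in> Hom C z a) \<and> (\<exists>!f. f \<in> Hom C a z))"

record ('o, 'm, 'p, 'n) cfunctor =
  on_obj :: "'o \<Rightarrow> 'p"
  on_arr :: "'m \<Rightarrow> 'n"

locale covariant_functor = A: category A + B: category B
  for A :: "('o, 'm, 'x) cat_scheme" and B :: "('p, 'n, 'y) cat_scheme" +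
  fixes F :: "('o, 'm, 'p, 'n) cfunctor"
  assumes on_obj: "a \<in> Obj A \<Longrightarrow> on_obj F a \<in> Obj B"
    and on_arr: "f \<in> Hom A a b \<Longrightarrow> on_arr F f \<in> Hom B (on_obj F a) (on_obj F b)"
    and on_idn: "a \<in> Obj A \<Longrightarrow> on_arr F (Idn A a) = Idn B (on_obj F a)"
    and on_comp: "\<lbrakk>f \<in> Hom A a b; g \<in> Hom A b c\<rbrakk>
      \<Longrightarrow> on_arr F (g \<cdot>\<^bsub>A\<^esub> f) = on_arr F g \<cdot>\<^bsub>B\<^esub> on_arr F f"

locale natural_transformation =
  F: covariant_functor A B F + G: covariant_functor A B G
  for A :: "('o, 'm, 'x) cat_scheme" and B :: "('p, 'n, 'y) cat_scheme"
    and F G :: "('o, 'm, 'p, 'n) cfunctor" +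
  fixes \<tau> :: "'o \<Rightarrow> 'n"
  assumes component: "a \<in> Obj A \<Longrightarrow> \<tau> a \<in> Hom B (on_obj F a) (on_obj G a)"
    and naturality: "f \<in> Hom A a b
      \<Longrightarrow> \<tau> b \<cdot>\<^bsub>B\<^esub> on_arr F f = on_arr G f \<cdot>\<^bsub>B\<^esub> \<tau> a"

definition naturally_isomorphic ::
  "('o, 'm, 'x) cat_scheme \<Rightarrow> ('p, 'n, 'y) cat_scheme
    \<Rightarrow> ('o, 'm, 'p, 'n) cfunctor \<Rightarrow> ('o, 'm, 'p, 'n) cfunctor \<Rightarrow> bool" where
  "naturally_isomorphic A B F G \<longleftrightarrow>
    (\<exists>\<tau>. natural_transformation A B F G \<tau> \<and> (\<forall>a \<in> Obj A. is_iso B (\<tau> a)))"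

record ('o, 'm) preadd_cat = "('o, 'm) cat" +
  Plus :: "'m \<Rightarrow> 'm \<Rightarrow> 'm"
  Zero :: "'o \<Rightarrow> 'o \<Rightarrow> 'm"

definition hom_group :: "('o, 'm, 'x) preadd_cat_scheme \<Rightarrow> 'o \<Rightarrow> 'o \<Rightarrow> 'm monoid" where
  "hom_group C a b = \<lparr>carrier = Hom C a b, mult = Plus C, one = Zero C a b\<rparr>"

locale preadditive_category = category C
  for C :: "('o, 'm, 'x) preadd_cat_scheme" (structure) +
  assumes hom_comm_group: "\<lbrakk>a \<in> Obj C; b \<in> Obj C\<rbrakk> \<Longrightarrow> comm_group (hom_group C a b)"
    and plus_comp: "\<lbrakk>f \<in> Hom C a b; g \<in> Hom C b c; h \<in> Hom C b c\<rbrakk>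
      \<Longrightarrow> Plus C g h \<cdot> f = Plus C (g \<cdot> f) (h \<cdot> f)"
    and comp_plus: "\<lbrakk>f \<in> Hom C a b; g \<in> Hom C a b; h \<in> Hom C b c\<rbrakk>
      \<Longrightarrow> h \<cdot> Plus C f g = Plus C (h \<cdot> f) (h \<cdot> g)"

definition is_kernel :: "('o, 'm, 'x) preadd_cat_scheme \<Rightarrow> 'm \<Rightarrow> 'm \<Rightarrow> bool" where
  "is_kernel C f k \<longleftrightarrow> f \<in> Arr C \<and> k \<in> Arr C \<and> Cod C k = Dom C f \<and>
    f \<cdot>\<^bsub>C\<^esub> k = Zero C (Dom C k) (Cod C f) \<and>
    (\<forall>a. \<forall>g \<in> Hom C a (Dom C f). f \<cdot>\<^bsub>C\<^esub> g = Zero C a (Cod C f) \<longrightarrow>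
      (\<exists>!h. h \<in> Hom C a (Dom C k) \<and> k \<cdot>\<^bsub>C\<^esub> h = g))"

definition is_cokernel :: "('o, 'm, 'x) preadd_cat_scheme \<Rightarrow> 'm \<Rightarrow> 'm \<Rightarrow> bool" where
  "is_cokernel C f c \<longleftrightarrow> f \<in> Arr C \<and> c \<in> Arr C \<and> Dom C c = Cod C f \<and>
    c \<cdot>\<^bsub>C\<^esub> f = Zero C (Dom C f) (Cod C c) \<and>
    (\<forall>b. \<forall>g \<in> Hom C (Cod C f) b. g \<cdot>\<^bsub>C\<^esub> f = Zero C (Dom C f) b \<longrightarrow>
      (\<exists>!h. h \<in> Hom C (Cod C c) b \<and> h \<cdot>\<^bsub>C\<^esub> c = g))"

definition is_image :: "('o, 'm, 'x) preadd_cat_scheme \<Rightarrow> 'm \<Rightarrow> 'm \<Rightarrow> bool" where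
  "is_image C f m \<longleftrightarrow> (\<exists>c. is_cokernel C f c \<and> is_kernel C c m)"

definition has_biproduct :: "('o, 'm, 'x) preadd_cat_scheme \<Rightarrow> 'o \<Rightarrow> 'o \<Rightarrow> bool" where
  "has_biproduct C a b \<longleftrightarrow> (\<exists>c \<in> Obj C.
    \<exists>i \<in> Hom C a c. \<exists>j \<in> Hom C b c. \<exists>p \<in> Hom C c a. \<exists>q \<in> Hom C c b.
      p \<cdot>\<^bsub>C\<^esub> i = Idn C a \<and> q \<cdot>\<^bsub>C\<^esub> j = Idn C b \<and>
      q \<cdot>\<^bsub>C\<^esub> i = Zero C a b \<and> p \<cdot>\<^bsub>C\<^esub> j = Zero C b a \<and>
      Plus C (i \<cdot>\<^bsub>C\<^esub> p) (j \<cdot>\<^bsub>C\<^esub> q) = Idn C c)"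

locale abelian_category = preadditive_category C
  for C :: "('o, 'm, 'x) preadd_cat_scheme" (structure) +
  assumes ex_zero_object: "\<exists>z. is_zero_object C z"
    and ex_biproduct: "\<lbrakk>a \<in> Obj C; b \<in> Obj C\<rbrakk> \<Longrightarrow> has_biproduct C a b"
    and ex_kernel: "f \<in> Arr C \<Longrightarrow> \<exists>k. is_kernel C f k"
    and ex_cokernel: "f \<in> Arr C \<Longrightarrow> \<exists>c. is_cokernel C f c"
    and mono_normal: "is_mono C f \<Longrightarrow> \<exists>g. is_kernel C g f"
    and epi_normal: "is_epi C f \<Longrightarrow> \<exists>g. is_cokernel C g f"

text \<open>Exactness at the middle object of \<open>a \<rightarrow> b \<rightarrow> c\<close>: the image of the first map
  and the kernel of the second are the same subobject of \<open>b\<close>.\<close>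

definition exact_at :: "('o, 'm, 'x) preadd_cat_scheme \<Rightarrow> 'm \<Rightarrow> 'm \<Rightarrow> bool" where
  "exact_at C f g \<longleftrightarrow> (\<exists>m. is_image C f m \<and> is_kernel C g m)"

text \<open>\<open>left_exact_seq C f g\<close>: the sequence \<open>0 \<rightarrow> a \<rightarrow> b \<rightarrow> c\<close> given by \<open>f\<close> and \<open>g\<close> is exact.\<close>

definition left_exact_seq :: "('o, 'm, 'x) preadd_cat_scheme \<Rightarrow> 'm \<Rightarrow> 'm \<Rightarrow> bool" where
  "left_exact_seq C f g \<longleftrightarrow>
    (\<exists>z. is_zero_object C z \<and> exact_at C (Zero C z (Dom C f)) f) \<and> exact_at C f g"

definition short_exact :: "('o, 'm, 'x) preadd_cat_scheme \<Rightarrow> 'm \<Rightarrow> 'm \<Rightarrow> bool" where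
  "short_exact C f g \<longleftrightarrow> left_exact_seq C f g \<and>
    (\<exists>z. is_zero_object C z \<and> exact_at C g (Zero C (Cod C g) z))"

definition injective_object :: "('o, 'm, 'x) cat_scheme \<Rightarrow> 'o \<Rightarrow> bool" where
  "injective_object C e \<longleftrightarrow> e \<in> Obj C \<and>
    (\<forall>m f. is_mono C m \<and> f \<in> Hom C (Dom C m) e \<longrightarrow>
      (\<exists>g \<in> Hom C (Cod C m) e. g \<cdot>\<^bsub>C\<^esub> m = f))"

definition enough_injectives :: "('o, 'm, 'x) cat_scheme \<Rightarrow> bool" where
  "enough_injectives C \<longleftrightarrow>
    (\<forall>a \<in> Obj C. \<exists>m. is_mono C m \<and> Dom C m = a \<and> injective_object C (Cod C m))"

locale additive_functor = covariant_functor A B F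
  for A :: "('o, 'm, 'x) preadd_cat_scheme" and B :: "('p, 'n, 'y) preadd_cat_scheme"
    and F :: "('o, 'm, 'p, 'n) cfunctor" +
  assumes additive: "\<lbrakk>a \<in> Obj A; b \<in> Obj A\<rbrakk>
    \<Longrightarrow> on_arr F \<in> hom (hom_group A a b) (hom_group B (on_obj F a) (on_obj F b))"

definition half_exact ::
  "('o, 'm, 'x) preadd_cat_scheme \<Rightarrow> ('p, 'n, 'y) preadd_cat_scheme
    \<Rightarrow> ('o, 'm, 'p, 'n) cfunctor \<Rightarrow> bool" where
  "half_exact A B F \<longleftrightarrow>
    (\<forall>f g. short_exact A f g \<longrightarrow> exact_at B (on_arr F f) (on_arr F g))"

text \<open>Kernels and images are represented by a chosen arrow into the ambient object; the
  kernel or image object itself is the domain of that arrow.\<close>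

definition ker :: "('o, 'm, 'x) preadd_cat_scheme \<Rightarrow> 'm \<Rightarrow> 'm" where
  "ker C f = (SOME k. is_kernel C f k)"

definition img :: "('o, 'm, 'x) preadd_cat_scheme \<Rightarrow> 'm \<Rightarrow> 'm" where
  "img C f = (SOME m. is_image C f m)"

text \<open>The choices entering the constructions: for every object \<open>a\<close> an exact sequence
  \<open>0 \<rightarrow> a \<rightarrow> I \<rightarrow> \<Sigma>a \<rightarrow> 0\<close> with \<open>I\<close> injective, respectively an exact sequence
  \<open>0 \<rightarrow> a \<rightarrow> I\<^sup>0 \<rightarrow> I\<^sup>1\<close> with \<open>I\<^sup>0\<close> and \<open>I\<^sup>1\<close> injective.\<close>

definition cosyzygy_choice ::
  "('o, 'm, 'x) preadd_cat_scheme \<Rightarrow> ('o \<Rightarrow> 'm) \<Rightarrow> ('o \<Rightarrow> 'm) \<Rightarrow> bool" where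
  "cosyzygy_choice A i p \<longleftrightarrow> (\<forall>a \<in> Obj A. Dom A (i a) = a \<and>
    short_exact A (i a) (p a) \<and> injective_object A (Cod A (i a)))"

definition copresentation_choice ::
  "('o, 'm, 'x) preadd_cat_scheme \<Rightarrow> ('o \<Rightarrow> 'm) \<Rightarrow> ('o \<Rightarrow> 'm) \<Rightarrow> bool" where
  "copresentation_choice A \<iota> \<delta> \<longleftrightarrow> (\<forall>a \<in> Obj A. Dom A (\<iota> a) = a \<and>
    left_exact_seq A (\<iota> a) (\<delta> a) \<and>
    injective_object A (Cod A (\<iota> a)) \<and> injective_object A (Cod A (\<delta> a)))"

text \<open>\<open>kernel_extension A B F i d\<close> is the pattern common to both constructions, for a choice
  of left exact sequences \<open>a \<rightarrow> J a \<rightarrow> K a\<close> with maps \<open>i a\<close> and \<open>d a\<close>. An object \<open>a\<close> goes to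
  the kernel of \<open>F (d a)\<close>. A morphism \<open>f : a \<rightarrow> b\<close> is extended to a morphism \<open>(f, g, g')\<close> of
  the chosen sequences, and goes to the map that \<open>F g\<close> induces on the kernels.\<close>

definition kernel_extension ::
  "('o, 'm, 'x) preadd_cat_scheme \<Rightarrow> ('p, 'n, 'y) preadd_cat_scheme
    \<Rightarrow> ('o, 'm, 'p, 'n) cfunctor \<Rightarrow> ('o \<Rightarrow> 'm) \<Rightarrow> ('o \<Rightarrow> 'm) \<Rightarrow> ('o, 'm, 'p, 'n) cfunctor" where
  "kernel_extension A B F i d =
    (let \<kappa> = (\<lambda>a. ker B (on_arr F (d a))) in
    \<lparr>on_obj = (\<lambda>a. Dom B (\<kappa> a)),
     on_arr = (\<lambda>f. let a = Dom A f; b = Cod A f in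
       (THE h. h \<in> Hom B (Dom B (\<kappa> a)) (Dom B (\<kappa> b)) \<and>
         (\<exists>g \<in> Hom A (Cod A (i a)) (Cod A (i b)). \<exists>g' \<in> Hom A (Cod A (d a)) (Cod A (d b)).
           g \<cdot>\<^bsub>A\<^esub> i a = i b \<cdot>\<^bsub>A\<^esub> f \<and> g' \<cdot>\<^bsub>A\<^esub> d a = d b \<cdot>\<^bsub>A\<^esub> g \<and>
           \<kappa> b \<cdot>\<^bsub>B\<^esub> h = on_arr F g \<cdot>\<^bsub>B\<^esub> \<kappa> a)))\<rparr>)"

text \<open>\<open>right_cosatellite\<close> is \<open>C\<^sup>1F\<close>; it is to be used with a \<open>cosyzygy_choice\<close>. The functor
  \<open>R\<^sup>0F\<close> and the map \<open>\<rho>\<close> are to be used with a \<open>copresentation_choice\<close>.\<close>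

definition right_cosatellite ::
  "('o, 'm, 'x) preadd_cat_scheme \<Rightarrow> ('p, 'n, 'y) preadd_cat_scheme
    \<Rightarrow> ('o, 'm, 'p, 'n) cfunctor \<Rightarrow> ('o \<Rightarrow> 'm) \<Rightarrow> ('o \<Rightarrow> 'm) \<Rightarrow> ('o, 'm, 'p, 'n) cfunctor" where
  "right_cosatellite A B F i p = kernel_extension A B F i p"

definition right_derived0 ::
  "('o, 'm, 'x) preadd_cat_scheme \<Rightarrow> ('p, 'n, 'y) preadd_cat_scheme
    \<Rightarrow> ('o, 'm, 'p, 'n) cfunctor \<Rightarrow> ('o \<Rightarrow> 'm) \<Rightarrow> ('o \<Rightarrow> 'm) \<Rightarrow> ('o, 'm, 'p, 'n) cfunctor" where
  "right_derived0 A B F \<iota> \<delta> = kernel_extension A B F \<iota> \<delta>"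

definition rho ::
  "('o, 'm, 'x) preadd_cat_scheme \<Rightarrow> ('p, 'n, 'y) preadd_cat_scheme
    \<Rightarrow> ('o, 'm, 'p, 'n) cfunctor \<Rightarrow> ('o \<Rightarrow> 'm) \<Rightarrow> ('o \<Rightarrow> 'm) \<Rightarrow> 'o \<Rightarrow> 'n" where
  "rho A B F \<iota> \<delta> a =
    (THE h. h \<in> Hom B (on_obj F a) (on_obj (right_derived0 A B F \<iota> \<delta>) a) \<and>
      ker B (on_arr F (\<delta> a)) \<cdot>\<^bsub>B\<^esub> h = on_arr F (\<iota> a))"

text \<open>The componentwise image of a natural transformation \<open>\<tau>\<close> with target \<open>G\<close>, with the
  structure of a subfunctor of \<open>G\<close>.\<close>

definition image_functor ::
  "('o, 'm, 'x) preadd_cat_scheme \<Rightarrow> ('p, 'n, 'y) preadd_cat_scheme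
    \<Rightarrow> ('o, 'm, 'p, 'n) cfunctor \<Rightarrow> ('o \<Rightarrow> 'n) \<Rightarrow> ('o, 'm, 'p, 'n) cfunctor" where
  "image_functor A B G \<tau> =
    \<lparr>on_obj = (\<lambda>a. Dom B (img B (\<tau> a))),
     on_arr = (\<lambda>f. THE h.
       h \<in> Hom B (Dom B (img B (\<tau> (Dom A f)))) (Dom B (img B (\<tau> (Cod A f)))) \<and>
       img B (\<tau> (Cod A f)) \<cdot>\<^bsub>B\<^esub> h = on_arr G f \<cdot>\<^bsub>B\<^esub> img B (\<tau> (Dom A f)))\<rparr>"

end

theory Submission
  imports Defs
begin

text \<open>Fix an object \<open>a\<close>, its cosyzygy sequence \<open>a \<rightarrow> I \<rightarrow> \<Sigma>a\<close> with maps \<open>i\<close> and \<open>p\<close>, and its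
  injective copresentation \<open>a \<rightarrow> I\<^sup>0 \<rightarrow> I\<^sup>1\<close> with maps \<open>\<iota>\<close> and \<open>\<delta>\<close>. Half-exactness, applied
  to the short exact sequence of \<open>i\<close> and \<open>p\<close>, says that \<open>ker F(p)\<close> is the image of \<open>F(i)\<close>; so
  \<open>F(i)\<close> induces an epimorphism \<open>\<epsilon> : F(a) \<rightarrow> C\<^sup>1F(a)\<close> (\<open>rho_epi\<close>). Since \<open>I\<close> and \<open>I\<^sup>0\<close> are
  both injective, \<open>i\<close> and \<open>\<iota>\<close> factor through each other, and hence so do \<open>F(i)\<close> and
  \<open>F(\<iota>)\<close>. Therefore \<open>\<rho>(a)\<close>, which is \<open>F(\<iota>)\<close> with its target restricted to \<open>ker F(\<delta>)\<close>,
  factors as \<open>\<theta> \<cdot> \<epsilon>\<close> with a monomorphism \<open>\<theta> : C\<^sup>1F(a) \<rightarrow> R\<^sup>0F(a)\<close> (\<open>rho_comparison\<close>). An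
  epi-mono factorization in an abelian category is an image factorization, so \<open>C\<^sup>1F(a)\<close> is the
  image of \<open>\<rho>(a)\<close>.

  Naturality of the isomorphism follows from that of \<open>\<epsilon>\<close> and \<open>\<rho>\<close>, whatever \<open>\<theta>\<close> is chosen
  for each \<open>a\<close>, because each square can be tested after composing with an epimorphism on
  one side and a monomorphism on the other (\<open>epi_mono_factorization_image_functor\<close>).

  The maps \<open>\<epsilon>\<close> and \<open>\<rho>\<close> are two instances of one construction. Both \<open>C\<^sup>1F\<close> and \<open>R\<^sup>0F\<close> send
  \<open>a\<close> to \<open>ker F(d a)\<close> for a left exact sequence \<open>a \<rightarrow> J a \<rightarrow> K a\<close> with \<open>J a\<close> injective, and
  \<open>F(a)\<close> maps to that kernel because \<open>d a \<cdot> i a = 0\<close>. The locale \<open>injective_copresentations\<close>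
  treats them together; functoriality rests on \<open>extensions_agree_on_kernel\<close>.\<close>

section \<open>Arrows of a preadditive category\<close>

context category
begin

lemma HomD:
  assumes "f \<in> Hom C a b"
  shows "f \<in> Arr C" and "Dom C f = a" and "Cod C f = b" and "a \<in> Obj C" and "b \<in> Obj C"
  using assms dom_obj cod_obj by (auto simp: Hom_def)

lemma arr_hom: "f \<in> Arr C \<Longrightarrow> f \<in> Hom C (Dom C f) (Cod C f)"
  by (simp add: Hom_def)

lemma mono_cancel:
  assumes "is_mono C m" "m \<in> Hom C a b" "g \<in> Hom C x a" "h \<in> Hom C x a" "m \<cdot> g = m \<cdot> h"
  shows "g = h"
  using assms unfolding is_mono_def by (auto simp: Hom_def)

lemma epi_cancel:
  assumes "is_epi C e" "e \<in> Hom C a b" "g \<in> Hom C b x" "h \<in> Hom C b x" "g \<cdot> e = h \<cdot> e"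
  shows "g = h"
  using assms unfolding is_epi_def by (auto simp: Hom_def)

lemma mono_comp:
  assumes m: "is_mono C m" "m \<in> Hom C a b" and n: "is_mono C n" "n \<in> Hom C b c"
  shows "is_mono C (n \<cdot> m)"
  unfolding is_mono_def
proof (intro conjI allI ballI impI)
  have nm: "n \<cdot> m \<in> Hom C a c" using comp_hom m n by blast
  then show "n \<cdot> m \<in> Arr C" by (rule HomD)
  fix x g h
  assume "g \<in> Hom C x (Dom C (n \<cdot> m))" and "h \<in> Hom C x (Dom C (n \<cdot> m))"
    and eq: "n \<cdot> m \<cdot> g = n \<cdot> m \<cdot> h"
  then have g: "g \<in> Hom C x a" and h: "h \<in> Hom C x a" using HomD(2)[OF nm] by simp_all
  have "n \<cdot> (m \<cdot> g) = n \<cdot> (m \<cdot> h)"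
    using eq comp_assoc[OF g m(2) n(2)] comp_assoc[OF h m(2) n(2)] by simp
  then have "m \<cdot> g = m \<cdot> h"
    using mono_cancel[OF n comp_hom[OF g m(2)] comp_hom[OF h m(2)]] by blast
  then show "g = h" using mono_cancel[OF m g h] by blast
qed

lemma epi_comp:
  assumes e: "is_epi C e" "e \<in> Hom C a b" and q: "is_epi C q" "q \<in> Hom C b c"
  shows "is_epi C (q \<cdot> e)"
  unfolding is_epi_def
proof (intro conjI allI ballI impI)
  have qe: "q \<cdot> e \<in> Hom C a c" using comp_hom e q by blast
  then show "q \<cdot> e \<in> Arr C" by (rule HomD)
  fix x g h
  assume "g \<in> Hom C (Cod C (q \<cdot> e)) x" and "h \<in> Hom C (Cod C (q \<cdot> e)) x"
    and eq: "g \<cdot> (q \<cdot> e) = h \<cdot> (q \<cdot> e)"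
  then have g: "g \<in> Hom C c x" and h: "h \<in> Hom C c x" using HomD(3)[OF qe] by simp_all
  have "g \<cdot> q \<cdot> e = h \<cdot> q \<cdot> e"
    using eq comp_assoc[OF e(2) q(2) g] comp_assoc[OF e(2) q(2) h] by simp
  then have "g \<cdot> q = h \<cdot> q"
    using epi_cancel[OF e comp_hom[OF q(2) g] comp_hom[OF q(2) h]] by blast
  then show "g = h" using epi_cancel[OF q g h] by blast
qed

end

context preadditive_category
begin

lemma zero_hom: "\<lbrakk>a \<in> Obj C; b \<in> Obj C\<rbrakk> \<Longrightarrow> Zero C a b \<in> Hom C a b"
  using comm_group.axioms(2)[OF hom_comm_group, THEN group.is_monoid, THEN monoid.one_closed]
  by (simp add: hom_group_def)

lemma zero_plus: "f \<in> Hom C a b \<Longrightarrow> Plus C (Zero C a b) f = f"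
  using comm_group.axioms(2)[OF hom_comm_group, THEN group.is_monoid, THEN monoid.l_one, of a b f]
    HomD(4,5) by (simp add: hom_group_def)

lemma zero_if_plus_absorbs:
  assumes f: "f \<in> Hom C a b" and g: "g \<in> Hom C a b" and eq: "Plus C f g = g"
  shows "f = Zero C a b"
proof -
  interpret G: comm_group "hom_group C a b" using hom_comm_group HomD[OF f] by blast
  show ?thesis using G.r_cancel_one[of g f] assms
    by (simp add: hom_group_def)
qed

lemma zero_comp_left:
  assumes f: "f \<in> Hom C a b" and c: "c \<in> Obj C"
  shows "Zero C b c \<cdot> f = Zero C a c"
proof -
  have z: "Zero C b c \<in> Hom C b c" using zero_hom HomD(5)[OF f] c by blast
  have "Plus C (Zero C b c \<cdot> f) (Zero C b c \<cdot> f) = Zero C b c \<cdot> f"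
    using plus_comp[OF f z z] zero_plus[OF z] by simp
  then show ?thesis using zero_if_plus_absorbs comp_hom[OF f z] by blast
qed

lemma zero_comp_right:
  assumes f: "f \<in> Hom C b c" and a: "a \<in> Obj C"
  shows "f \<cdot> Zero C a b = Zero C a c"
proof -
  have z: "Zero C a b \<in> Hom C a b" using zero_hom HomD(4)[OF f] a by blast
  have "Plus C (f \<cdot> Zero C a b) (f \<cdot> Zero C a b) = f \<cdot> Zero C a b"
    using comp_plus[OF z z f] zero_plus[OF z] by simp
  then show ?thesis using zero_if_plus_absorbs comp_hom[OF z f] by blast
qed

lemma hom_difference:
  assumes g: "g \<in> Hom C a b" and h: "h \<in> Hom C a b"
  obtains t where "t \<in> Hom C a b" and "g = Plus C t h"
proof -
  interpret G: comm_group "hom_group C a b" using hom_comm_group HomD[OF g] by blast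
  have c: "carrier (hom_group C a b) = Hom C a b" by (simp add: hom_group_def)
  let ?t = "g \<otimes>\<^bsub>hom_group C a b\<^esub> inv\<^bsub>hom_group C a b\<^esub> h"
  have "?t \<in> Hom C a b" using g h c G.m_closed G.inv_closed by metis
  moreover have "?t \<otimes>\<^bsub>hom_group C a b\<^esub> h = g" using g h unfolding c[symmetric] by (simp add: G.m_assoc)
  ultimately show thesis using that[of ?t] by (simp add: hom_group_def)
qed

lemma precomp_difference:
  assumes f: "f \<in> Hom C a b" and g: "g \<in> Hom C b c" and h: "h \<in> Hom C b c"
    and eq: "g \<cdot> f = h \<cdot> f"
  obtains t where "t \<in> Hom C b c" and "g = Plus C t h" and "t \<cdot> f = Zero C a c"
proof -
  obtain t where t: "t \<in> Hom C b c" "g = Plus C t h" using hom_difference[OF g h] .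
  have "Plus C (t \<cdot> f) (h \<cdot> f) = h \<cdot> f" using plus_comp[OF f t(1) h] t(2) eq by simp
  then have "t \<cdot> f = Zero C a c"
    using zero_if_plus_absorbs comp_hom[OF f t(1)] comp_hom[OF f h] by blast
  then show thesis using that t by blast
qed

lemma postcomp_difference:
  assumes f: "f \<in> Hom C b c" and g: "g \<in> Hom C a b" and h: "h \<in> Hom C a b"
    and eq: "f \<cdot> g = f \<cdot> h"
  obtains t where "t \<in> Hom C a b" and "g = Plus C t h" and "f \<cdot> t = Zero C a c"
proof -
  obtain t where t: "t \<in> Hom C a b" "g = Plus C t h" using hom_difference[OF g h] .
  have "Plus C (f \<cdot> t) (f \<cdot> h) = f \<cdot> h" using comp_plus[OF t(1) h f] t(2) eq by simp
  then have "f \<cdot> t = Zero C a c"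
    using zero_if_plus_absorbs comp_hom[OF t(1) f] comp_hom[OF h f] by blast
  then show thesis using that t by blast
qed

lemma monoI_zero:
  assumes f: "f \<in> Hom C a b"
    and zero: "\<And>x t. \<lbrakk>t \<in> Hom C x a; f \<cdot> t = Zero C x b\<rbrakk> \<Longrightarrow> t = Zero C x a"
  shows "is_mono C f"
  unfolding is_mono_def
proof (intro conjI allI ballI impI)
  show "f \<in> Arr C" using HomD(1)[OF f] .
  fix x g h
  assume "g \<in> Hom C x (Dom C f)" and "h \<in> Hom C x (Dom C f)" and eq: "f \<cdot> g = f \<cdot> h"
  then have g: "g \<in> Hom C x a" and h: "h \<in> Hom C x a" using HomD(2)[OF f] by simp_all
  obtain t where t: "t \<in> Hom C x a" "g = Plus C t h" "f \<cdot> t = Zero C x b"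
    using postcomp_difference[OF f g h eq] .
  then show "g = h" using zero zero_plus[OF h] by simp
qed

lemma epiI_zero:
  assumes f: "f \<in> Hom C a b"
    and zero: "\<And>x t. \<lbrakk>t \<in> Hom C b x; t \<cdot> f = Zero C a x\<rbrakk> \<Longrightarrow> t = Zero C b x"
  shows "is_epi C f"
  unfolding is_epi_def
proof (intro conjI allI ballI impI)
  show "f \<in> Arr C" using HomD(1)[OF f] .
  fix x g h
  assume "g \<in> Hom C (Cod C f) x" and "h \<in> Hom C (Cod C f) x" and eq: "g \<cdot> f = h \<cdot> f"
  then have g: "g \<in> Hom C b x" and h: "h \<in> Hom C b x" using HomD(3)[OF f] by simp_all
  obtain t where t: "t \<in> Hom C b x" "g = Plus C t h" "t \<cdot> f = Zero C a x"
    using precomp_difference[OF f g h eq] .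
  then show "g = h" using zero zero_plus[OF h] by simp
qed

lemma mono_zero:
  assumes m: "is_mono C m" "m \<in> Hom C a b" and t: "t \<in> Hom C x a" "m \<cdot> t = Zero C x b"
  shows "t = Zero C x a"
proof -
  have "m \<cdot> t = m \<cdot> Zero C x a" using zero_comp_right[OF m(2)] HomD[OF t(1)] t by simp
  then show ?thesis
    using mono_cancel[OF m t(1)] zero_hom HomD[OF t(1)] by blast
qed

lemma epi_zero:
  assumes e: "is_epi C e" "e \<in> Hom C a b" and t: "t \<in> Hom C b x" "t \<cdot> e = Zero C a x"
  shows "t = Zero C b x"
proof -
  have "t \<cdot> e = Zero C b x \<cdot> e" using zero_comp_left[OF e(2)] HomD[OF t(1)] t by simp
  then show ?thesis
    using epi_cancel[OF e t(1)] zero_hom HomD[OF t(1)] by blast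
qed

section \<open>Kernels, cokernels and images\<close>

lemma kernelD:
  assumes k: "is_kernel C f k" and f: "f \<in> Hom C a b"
  shows "k \<in> Hom C (Dom C k) a" and "f \<cdot> k = Zero C (Dom C k) b"
  using assms unfolding is_kernel_def by (auto simp: Hom_def)

lemma cokernelD:
  assumes c: "is_cokernel C f c" and f: "f \<in> Hom C a b"
  shows "c \<in> Hom C b (Cod C c)" and "c \<cdot> f = Zero C a (Cod C c)"
  using assms unfolding is_cokernel_def by (auto simp: Hom_def)

lemma kernel_lift:
  assumes k: "is_kernel C f k" and f: "f \<in> Hom C a b"
    and g: "g \<in> Hom C x a" "f \<cdot> g = Zero C x b"
  obtains h where "h \<in> Hom C x (Dom C k)" and "k \<cdot> h = g"
proof -
  have "\<exists>!h. h \<in> Hom C x (Dom C k) \<and> k \<cdot> h = g"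
    using k g HomD[OF f] unfolding is_kernel_def by auto
  then show thesis using that by blast
qed

lemma cokernel_descend:
  assumes c: "is_cokernel C f c" and f: "f \<in> Hom C a b"
    and g: "g \<in> Hom C b x" "g \<cdot> f = Zero C a x"
  obtains h where "h \<in> Hom C (Cod C c) x" and "h \<cdot> c = g"
proof -
  have "\<exists>!h. h \<in> Hom C (Cod C c) x \<and> h \<cdot> c = g"
    using c g HomD[OF f] unfolding is_cokernel_def by auto
  then show thesis using that by blast
qed

lemma kernel_mono:
  assumes k: "is_kernel C f k"
  shows "is_mono C k"
  unfolding is_mono_def
proof (intro conjI allI ballI impI)
  have f: "f \<in> Hom C (Dom C f) (Cod C f)"
    using k arr_hom unfolding is_kernel_def by blast
  note k' = kernelD[OF k f]
  show "k \<in> Arr C" using HomD(1)[OF k'(1)] .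
  fix x g h
  assume g: "g \<in> Hom C x (Dom C k)" and h: "h \<in> Hom C x (Dom C k)" and eq: "k \<cdot> g = k \<cdot> h"
  have "f \<cdot> (k \<cdot> h) = Zero C x (Cod C f)"
    using comp_assoc[OF h k'(1) f] zero_comp_left[OF h] k'(2) HomD[OF f] by simp
  then have "\<exists>!u. u \<in> Hom C x (Dom C k) \<and> k \<cdot> u = k \<cdot> h"
    using k comp_hom[OF h k'(1)] unfolding is_kernel_def by blast
  then show "g = h" using g h eq by blast
qed

lemma cokernel_epi:
  assumes c: "is_cokernel C f c"
  shows "is_epi C c"
  unfolding is_epi_def
proof (intro conjI allI ballI impI)
  have f: "f \<in> Hom C (Dom C f) (Cod C f)"
    using c arr_hom unfolding is_cokernel_def by blast
  note c' = cokernelD[OF c f]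
  show "c \<in> Arr C" using HomD(1)[OF c'(1)] .
  fix x g h
  assume g: "g \<in> Hom C (Cod C c) x" and h: "h \<in> Hom C (Cod C c) x" and eq: "g \<cdot> c = h \<cdot> c"
  have "h \<cdot> c \<cdot> f = Zero C (Dom C f) x"
    using comp_assoc[OF f c'(1) h] zero_comp_right[OF h] c'(2) HomD[OF f] by simp
  then have "\<exists>!u. u \<in> Hom C (Cod C c) x \<and> u \<cdot> c = h \<cdot> c"
    using c comp_hom[OF c'(1) h] unfolding is_cokernel_def by blast
  then show "g = h" using g h eq by blast
qed

text \<open>For a monomorphism the uniqueness of lifts is automatic, so only their existence has to be
  verified.\<close>
lemma kernelI_mono:
  assumes f: "f \<in> Hom C a b" and k: "is_mono C k" "k \<in> Hom C d a" "f \<cdot> k = Zero C d b"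
    and lift: "\<And>x g. \<lbrakk>g \<in> Hom C x a; f \<cdot> g = Zero C x b\<rbrakk> \<Longrightarrow> \<exists>h \<in> Hom C x d. k \<cdot> h = g"
  shows "is_kernel C f k"
  unfolding is_kernel_def
proof (intro conjI allI ballI impI)
  show "f \<in> Arr C" "k \<in> Arr C" "Cod C k = Dom C f" "f \<cdot> k = Zero C (Dom C k) (Cod C f)"
    using HomD[OF f] HomD[OF k(2)] k(3) by simp_all
  fix x g assume "g \<in> Hom C x (Dom C f)" "f \<cdot> g = Zero C x (Cod C f)"
  then have "\<exists>h \<in> Hom C x d. k \<cdot> h = g" using lift HomD[OF f] by simp
  then show "\<exists>!h. h \<in> Hom C x (Dom C k) \<and> k \<cdot> h = g"
    using mono_cancel[OF k(1,2)] HomD(2)[OF k(2)] by metis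
qed

lemma imageE:
  assumes m: "is_image C f m" and f: "f \<in> Hom C a b"
  obtains c where "is_cokernel C f c" "c \<in> Hom C b (Cod C c)" "is_kernel C c m"
    "m \<in> Hom C (Dom C m) b" "is_mono C m"
proof -
  obtain c where c: "is_cokernel C f c" "is_kernel C c m"
    using m unfolding is_image_def by blast
  show thesis
    using that[OF c(1) cokernelD(1)[OF c(1) f] c(2) kernelD(1)[OF c(2) cokernelD(1)[OF c(1) f]]
        kernel_mono[OF c(2)]] .
qed

lemma imageD:
  assumes m: "is_image C f m" and f: "f \<in> Hom C a b"
  shows "m \<in> Hom C (Dom C m) b" and "is_mono C m"
  using imageE[OF m f] by blast+

lemma image_factor:
  assumes m: "is_image C f m" and f: "f \<in> Hom C a b"
  obtains e where "e \<in> Hom C a (Dom C m)" and "m \<cdot> e = f"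
proof -
  obtain c where c: "is_cokernel C f c" "c \<in> Hom C b (Cod C c)" "is_kernel C c m"
    using imageE[OF m f] .
  show thesis using kernel_lift[OF c(3,2) f cokernelD(2)[OF c(1) f]] that .
qed

lemma image_comparison:
  assumes m: "is_image C f m" and m': "is_image C f m'" and f: "f \<in> Hom C a b"
  obtains t where "t \<in> Hom C (Dom C m) (Dom C m')" and "m' \<cdot> t = m"
proof -
  obtain c where c: "is_cokernel C f c" "c \<in> Hom C b (Cod C c)" "is_kernel C c m"
      "m \<in> Hom C (Dom C m) b"
    using imageE[OF m f] .
  obtain c' where c': "is_cokernel C f c'" "c' \<in> Hom C b (Cod C c')" "is_kernel C c' m'"
    using imageE[OF m' f] .
  obtain y where y: "y \<in> Hom C (Cod C c) (Cod C c')" "y \<cdot> c = c'"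
    using cokernel_descend[OF c(1) f c'(2) cokernelD(2)[OF c'(1) f]] .
  have "c' \<cdot> m = Zero C (Dom C m) (Cod C c')"
    using comp_assoc[OF c(4,2) y(1)] y(2) kernelD(2)[OF c(3,2)] zero_comp_right[OF y(1)]
      HomD[OF c(4)] by simp
  then show thesis using kernel_lift[OF c'(3,2) c(4)] that by blast
qed

lemma image_unique:
  assumes m: "is_image C f m" and m': "is_image C f m'" and f: "f \<in> Hom C a b"
  obtains t where "t \<in> Hom C (Dom C m) (Dom C m')" and "m' \<cdot> t = m" and "is_iso C t"
proof -
  obtain t where t: "t \<in> Hom C (Dom C m) (Dom C m')" "m' \<cdot> t = m"
    using image_comparison[OF m m' f] .
  obtain s where s: "s \<in> Hom C (Dom C m') (Dom C m)" "m \<cdot> s = m'"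
    using image_comparison[OF m' m f] .
  note mm = imageD[OF m f]
  note mm' = imageD[OF m' f]
  have "m \<cdot> (s \<cdot> t) = m \<cdot> Idn C (Dom C m)"
    using comp_assoc[OF t(1) s(1) mm(1)] s t comp_idn[OF mm(1)] by simp
  then have 1: "s \<cdot> t = Idn C (Dom C m)"
    using mono_cancel[OF mm(2,1) comp_hom[OF t(1) s(1)] idn_hom] HomD(4)[OF t(1)] by blast
  have "m' \<cdot> (t \<cdot> s) = m' \<cdot> Idn C (Dom C m')"
    using comp_assoc[OF s(1) t(1) mm'(1)] s t comp_idn[OF mm'(1)] by simp
  then have 2: "t \<cdot> s = Idn C (Dom C m')"
    using mono_cancel[OF mm'(2,1) comp_hom[OF s(1) t(1)] idn_hom] HomD(4)[OF s(1)] by blast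
  have "is_iso C t"
    unfolding is_iso_def using 1 2 s(1) HomD[OF t(1)] by auto
  then show thesis using that t by blast
qed

end

context abelian_category
begin

lemma ker_is_kernel: "f \<in> Hom C a b \<Longrightarrow> is_kernel C f (ker C f)"
  unfolding ker_def using ex_kernel HomD(1) someI_ex by metis

lemma ex_image:
  assumes f: "f \<in> Hom C a b"
  shows "\<exists>m. is_image C f m"
proof -
  obtain c where c: "is_cokernel C f c" using ex_cokernel HomD(1)[OF f] by blast
  then obtain m where "is_kernel C c m" using ex_kernel HomD(1)[OF cokernelD(1)[OF c f]] by blast
  then show ?thesis using c unfolding is_image_def by blast
qed

lemma img_is_image: "f \<in> Hom C a b \<Longrightarrow> is_image C f (img C f)"
  unfolding img_def using ex_image someI_ex by metis

text \<open>If \<open>t \<cdot> e = 0\<close>, then \<open>f\<close> factors through the subobject \<open>m \<cdot> n\<close> of \<open>m\<close>, where \<open>n\<close> is the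
  kernel of \<open>t\<close>. The image is the smallest subobject through which \<open>f\<close> factors, because every
  subobject is a kernel; so \<open>n\<close> is split by some \<open>s\<close>, and \<open>t = t \<cdot> n \<cdot> s = 0\<close>.\<close>
lemma image_factor_epi:
  assumes m: "is_image C f m" and f: "f \<in> Hom C a b"
    and e: "e \<in> Hom C a (Dom C m)" "m \<cdot> e = f"
  shows "is_epi C e"
proof (rule epiI_zero[OF e(1)])
  fix x t assume t: "t \<in> Hom C (Dom C m) x" "t \<cdot> e = Zero C a x"
  obtain c where c: "is_cokernel C f c" "c \<in> Hom C b (Cod C c)" "is_kernel C c m"
    and mm: "m \<in> Hom C (Dom C m) b" "is_mono C m"
    using imageE[OF m f] .
  obtain n where n: "is_kernel C t n" using ex_kernel HomD(1)[OF t(1)] by blast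
  note nh = kernelD[OF n t(1)]
  obtain e' where e': "e' \<in> Hom C a (Dom C n)" "n \<cdot> e' = e"
    using kernel_lift[OF n t(1) e(1) t(2)] .
  have mn: "m \<cdot> n \<in> Hom C (Dom C n) b" using comp_hom[OF nh(1) mm(1)] .
  have "is_mono C (m \<cdot> n)" using mono_comp[OF kernel_mono[OF n] nh(1) mm(2,1)] .
  then obtain g where g: "is_kernel C g (m \<cdot> n)" using mono_normal by blast
  then have gh: "g \<in> Hom C b (Cod C g)"
    using HomD[OF mn] unfolding is_kernel_def Hom_def by auto
  have gmn: "g \<cdot> (m \<cdot> n) = Zero C (Dom C n) (Cod C g)"
    using kernelD(2)[OF g gh] HomD[OF mn] by simp
  have "m \<cdot> n \<cdot> e' = f" using comp_assoc[OF e'(1) nh(1) mm(1)] e e' by simp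
  then have "g \<cdot> f = Zero C a (Cod C g)"
    using comp_assoc[OF e'(1) mn gh] gmn zero_comp_left[OF e'(1)] HomD[OF gh] by simp
  then obtain y where y: "y \<in> Hom C (Cod C c) (Cod C g)" "y \<cdot> c = g"
    using cokernel_descend[OF c(1) f gh] by blast
  have "g \<cdot> m = Zero C (Dom C m) (Cod C g)"
    using comp_assoc[OF mm(1) c(2) y(1)] y(2) kernelD(2)[OF c(3,2)] zero_comp_right[OF y(1)]
      HomD[OF mm(1)] by simp
  then obtain s where "s \<in> Hom C (Dom C m) (Dom C (m \<cdot> n))" "m \<cdot> n \<cdot> s = m"
    using kernel_lift[OF g gh mm(1)] by blast
  then have s: "s \<in> Hom C (Dom C m) (Dom C n)" "m \<cdot> n \<cdot> s = m" using HomD[OF mn] by simp_all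
  have "m \<cdot> (n \<cdot> s) = m \<cdot> Idn C (Dom C m)"
    using comp_assoc[OF s(1) nh(1) mm(1)] s(2) comp_idn[OF mm(1)] by simp
  then have ns: "n \<cdot> s = Idn C (Dom C m)"
    using mono_cancel[OF mm(2,1) comp_hom[OF s(1) nh(1)] idn_hom] HomD(4)[OF mm(1)] by blast
  have "t = t \<cdot> n \<cdot> s" using comp_assoc[OF s(1) nh(1) t(1)] ns comp_idn[OF t(1)] by simp
  then show "t = Zero C (Dom C m) x"
    using nh(2) zero_comp_left[OF s(1)] HomD[OF t(1)] by simp
qed

text \<open>The dual of the preceding argument: if \<open>j \<cdot> t = 0\<close>, then \<open>d\<close> factors through the quotient
  \<open>q \<cdot> c\<close>, where \<open>q\<close> is the cokernel of \<open>t\<close>; the coimage is the smallest such quotient, so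
  \<open>q\<close> is split.\<close>
lemma coimage_factor_mono:
  assumes d: "d \<in> Hom C a b" and m: "is_kernel C d m" and c: "is_cokernel C m c"
    and j: "j \<in> Hom C (Cod C c) b" "j \<cdot> c = d"
  shows "is_mono C j"
proof (rule monoI_zero[OF j(1)])
  fix x t assume t: "t \<in> Hom C x (Cod C c)" "j \<cdot> t = Zero C x b"
  note mm = kernelD[OF m d]
  note ch = cokernelD[OF c mm(1)]
  obtain q where q: "is_cokernel C t q" using ex_cokernel HomD(1)[OF t(1)] by blast
  note qh = cokernelD[OF q t(1)]
  obtain j' where j': "j' \<in> Hom C (Cod C q) b" "j' \<cdot> q = j"
    using cokernel_descend[OF q t(1) j(1) t(2)] .
  have qc: "q \<cdot> c \<in> Hom C a (Cod C q)" using comp_hom[OF ch(1) qh(1)] .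
  have "is_epi C (q \<cdot> c)" using epi_comp[OF cokernel_epi[OF c] ch(1) cokernel_epi[OF q] qh(1)] .
  then obtain g where g: "is_cokernel C g (q \<cdot> c)" using epi_normal by blast
  then have gh: "g \<in> Hom C (Dom C g) a"
    using HomD[OF qc] unfolding is_cokernel_def Hom_def by auto
  have qcg: "q \<cdot> c \<cdot> g = Zero C (Dom C g) (Cod C q)"
    using cokernelD(2)[OF g gh] HomD[OF qc] by simp
  have "j' \<cdot> (q \<cdot> c) = d" using comp_assoc[OF ch(1) qh(1) j'(1)] j j' by simp
  then have "d \<cdot> g = Zero C (Dom C g) b"
    using comp_assoc[OF gh qc j'(1)] qcg zero_comp_right[OF j'(1)] HomD[OF gh] by simp
  then obtain y where y: "y \<in> Hom C (Dom C g) (Dom C m)" "m \<cdot> y = g"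
    using kernel_lift[OF m d gh] by blast
  have "c \<cdot> g = Zero C (Dom C g) (Cod C c)"
    using comp_assoc[OF y(1) mm(1) ch(1)] y(2) ch(2) zero_comp_left[OF y(1)]
      HomD[OF ch(1)] by simp
  then obtain s where "s \<in> Hom C (Cod C (q \<cdot> c)) (Cod C c)" "s \<cdot> (q \<cdot> c) = c"
    using cokernel_descend[OF g gh ch(1)] by blast
  then have s: "s \<in> Hom C (Cod C q) (Cod C c)" "s \<cdot> (q \<cdot> c) = c" using HomD[OF qc] by simp_all
  have "s \<cdot> q \<cdot> c = Idn C (Cod C c) \<cdot> c"
    using comp_assoc[OF ch(1) qh(1) s(1)] s(2) idn_comp[OF ch(1)] by simp
  then have sq: "s \<cdot> q = Idn C (Cod C c)"
    using epi_cancel[OF cokernel_epi[OF c] ch(1) comp_hom[OF qh(1) s(1)] idn_hom]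
      HomD(5)[OF ch(1)] by blast
  have "t = s \<cdot> (q \<cdot> t)" using comp_assoc[OF t(1) qh(1) s(1)] sq idn_comp[OF t(1)] by simp
  then show "t = Zero C x (Cod C c)"
    using qh(2) zero_comp_right[OF s(1)] HomD[OF t(1)] by simp
qed

text \<open>The monomorphism \<open>n\<close> is the kernel of some \<open>g\<close>. As \<open>e\<close> is epi, an arrow kills \<open>n \<cdot> e\<close> exactly
  if it kills \<open>n\<close>; so \<open>g\<close> factors through the cokernel \<open>c\<close> of \<open>n \<cdot> e\<close>, and \<open>n\<close> is also the
  kernel of \<open>c\<close>.\<close>
lemma epi_mono_is_image:
  assumes e: "is_epi C e" "e \<in> Hom C a m" and n: "is_mono C n" "n \<in> Hom C m b"
  shows "is_image C (n \<cdot> e) n"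
proof -
  have f: "n \<cdot> e \<in> Hom C a b" using comp_hom[OF e(2) n(2)] .
  obtain c where c: "is_cokernel C (n \<cdot> e) c" using ex_cokernel HomD(1)[OF f] by blast
  note ch = cokernelD[OF c f]
  obtain g where g: "is_kernel C g n" using mono_normal n(1) by blast
  then have gh: "g \<in> Hom C b (Cod C g)"
    using HomD[OF n(2)] unfolding is_kernel_def Hom_def by auto
  have gn: "g \<cdot> n = Zero C m (Cod C g)" using kernelD(2)[OF g gh] HomD[OF n(2)] by simp
  have "is_kernel C c n"
  proof (rule kernelI_mono[OF ch(1) n])
    have "c \<cdot> n \<cdot> e = Zero C a (Cod C c)" using ch(2) comp_assoc[OF e(2) n(2) ch(1)] by simp
    then show "c \<cdot> n = Zero C m (Cod C c)" using epi_zero[OF e comp_hom[OF n(2) ch(1)]] by blast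
  next
    fix x u assume u: "u \<in> Hom C x b" "c \<cdot> u = Zero C x (Cod C c)"
    have "g \<cdot> (n \<cdot> e) = Zero C a (Cod C g)"
      using comp_assoc[OF e(2) n(2) gh] gn zero_comp_left[OF e(2)] HomD[OF gh] by simp
    then obtain y where y: "y \<in> Hom C (Cod C c) (Cod C g)" "y \<cdot> c = g"
      using cokernel_descend[OF c f gh] by blast
    have "g \<cdot> u = Zero C x (Cod C g)"
      using comp_assoc[OF u(1) ch(1) y(1)] y(2) u(2) zero_comp_right[OF y(1)] HomD[OF u(1)]
      by simp
    then show "\<exists>h \<in> Hom C x m. n \<cdot> h = u"
      using kernel_lift[OF g gh u(1)] HomD[OF n(2)] by metis
  qed
  then show ?thesis using c unfolding is_image_def by blast
qed

section \<open>Exact sequences\<close>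

lemma exact_atE:
  assumes ex: "exact_at C f g" and f: "f \<in> Hom C a b"
  obtains m e where "is_image C f m" "is_kernel C g m" "g \<in> Hom C b (Cod C g)"
    "m \<in> Hom C (Dom C m) b" "e \<in> Hom C a (Dom C m)" "m \<cdot> e = f" "is_epi C e"
proof -
  obtain m where m: "is_image C f m" "is_kernel C g m" using ex unfolding exact_at_def by blast
  have mm: "m \<in> Hom C (Dom C m) b" using imageE[OF m(1) f] .
  have g: "g \<in> Hom C b (Cod C g)"
    using m(2) HomD[OF mm] unfolding is_kernel_def Hom_def by auto
  obtain e where e: "e \<in> Hom C a (Dom C m)" "m \<cdot> e = f" using image_factor[OF m(1) f] .
  show thesis using that[OF m g mm e image_factor_epi[OF m(1) f e]] .
qed

lemma exact_at_composite:
  assumes ex: "exact_at C f g" and f: "f \<in> Hom C a b"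
  shows "g \<in> Hom C b (Cod C g)" and "g \<cdot> f = Zero C a (Cod C g)"
proof -
  obtain m e where m: "is_kernel C g m" "g \<in> Hom C b (Cod C g)" "m \<in> Hom C (Dom C m) b"
    and e: "e \<in> Hom C a (Dom C m)" "m \<cdot> e = f" using exact_atE[OF ex f] by metis
  show "g \<in> Hom C b (Cod C g)" using m by blast
  show "g \<cdot> f = Zero C a (Cod C g)"
    using comp_assoc[OF e(1) m(3,2)] e(2) kernelD(2)[OF m(1,2)] zero_comp_left[OF e(1)]
      HomD[OF m(2)] by simp
qed

lemma left_exact_hom:
  assumes "left_exact_seq C f g"
  shows "f \<in> Hom C (Dom C f) (Cod C f)" and "g \<in> Hom C (Cod C f) (Cod C g)"
    and "g \<cdot> f = Zero C (Dom C f) (Cod C g)"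
proof -
  show f: "f \<in> Hom C (Dom C f) (Cod C f)"
    using assms arr_hom unfolding left_exact_seq_def exact_at_def is_kernel_def by blast
  show "g \<in> Hom C (Cod C f) (Cod C g)" "g \<cdot> f = Zero C (Dom C f) (Cod C g)"
    using assms exact_at_composite[OF _ f] unfolding left_exact_seq_def by blast+
qed

text \<open>Exactness at \<open>a\<close> makes the kernel of \<open>f\<close> the image of a zero map. The cokernel of a zero map
  has a left inverse, so the kernel of that cokernel is zero.\<close>
lemma left_exact_mono:
  assumes le: "left_exact_seq C f g"
  shows "is_mono C f"
proof -
  let ?a = "Dom C f"
  have f: "f \<in> Hom C ?a (Cod C f)" using left_exact_hom[OF le] by blast
  have a: "?a \<in> Obj C" using HomD[OF f] by blast
  obtain z where z: "is_zero_object C z" and ex: "exact_at C (Zero C z ?a) f"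
    using le unfolding left_exact_seq_def by blast
  have z0: "Zero C z ?a \<in> Hom C z ?a" using zero_hom z a unfolding is_zero_object_def by blast
  obtain m where m: "is_image C (Zero C z ?a) m" "is_kernel C f m"
    using ex unfolding exact_at_def by blast
  obtain c where c: "is_cokernel C (Zero C z ?a) c" "c \<in> Hom C ?a (Cod C c)" "is_kernel C c m"
    and mm: "m \<in> Hom C (Dom C m) ?a" using imageE[OF m(1) z0] .
  have "Idn C ?a \<cdot> Zero C z ?a = Zero C z ?a" using idn_comp[OF z0] .
  then obtain r where r: "r \<in> Hom C (Cod C c) ?a" "r \<cdot> c = Idn C ?a"
    using cokernel_descend[OF c(1) z0 idn_hom[OF a]] by blast
  have "m = r \<cdot> (c \<cdot> m)" using comp_assoc[OF mm c(2) r(1)] r(2) idn_comp[OF mm] by simp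
  then have m0: "m = Zero C (Dom C m) ?a"
    using kernelD(2)[OF c(3,2)] zero_comp_right[OF r(1)] HomD[OF mm] by metis
  show ?thesis
  proof (rule monoI_zero[OF f])
    fix x t assume t: "t \<in> Hom C x ?a" "f \<cdot> t = Zero C x (Cod C f)"
    obtain y where y: "y \<in> Hom C x (Dom C m)" "m \<cdot> y = t" using kernel_lift[OF m(2) f t] .
    then show "t = Zero C x ?a" using zero_comp_left[OF y(1) a] m0 by metis
  qed
qed

text \<open>Dually, the kernel of the map to the zero object has a right inverse; this kernel is also the
  image of \<open>g\<close>, so the cokernel of \<open>g\<close> is zero.\<close>
lemma short_exact_epi:
  assumes se: "short_exact C f g"
  shows "is_epi C g"
proof -
  let ?b = "Cod C g"
  have g: "g \<in> Hom C (Cod C f) ?b"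
    using se left_exact_hom unfolding short_exact_def by blast
  have b: "?b \<in> Obj C" using HomD[OF g] by blast
  obtain z where z: "is_zero_object C z" and ex: "exact_at C g (Zero C ?b z)"
    using se unfolding short_exact_def by blast
  have z0: "Zero C ?b z \<in> Hom C ?b z" using zero_hom z b unfolding is_zero_object_def by blast
  obtain m where m: "is_image C g m" "is_kernel C (Zero C ?b z) m"
    using ex unfolding exact_at_def by blast
  obtain c where c: "is_cokernel C g c" "c \<in> Hom C ?b (Cod C c)" "is_kernel C c m"
    and mm: "m \<in> Hom C (Dom C m) ?b" using imageE[OF m(1) g] .
  have "Zero C ?b z \<cdot> Idn C ?b = Zero C ?b z" using comp_idn[OF z0] .
  then obtain r where r: "r \<in> Hom C ?b (Dom C m)" "m \<cdot> r = Idn C ?b"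
    using kernel_lift[OF m(2) z0 idn_hom[OF b]] by blast
  have "c = c \<cdot> m \<cdot> r" using comp_assoc[OF r(1) mm c(2)] r(2) comp_idn[OF c(2)] by simp
  then have c0: "c = Zero C ?b (Cod C c)"
    using kernelD(2)[OF c(3,2)] zero_comp_left[OF r(1)] HomD[OF c(2)] by metis
  show ?thesis
  proof (rule epiI_zero[OF g])
    fix x t assume t: "t \<in> Hom C ?b x" "t \<cdot> g = Zero C (Cod C f) x"
    obtain y where y: "y \<in> Hom C (Cod C c) x" "y \<cdot> c = t" using cokernel_descend[OF c(1) g t] .
    then show "t = Zero C ?b x" using zero_comp_right[OF y(1) b] c0 by metis
  qed
qed

text \<open>Up to an epimorphism, \<open>f\<close> is the kernel of \<open>g\<close>; so whatever kills \<open>f\<close> kills that kernel.\<close>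
lemma exact_at_kernel_zero:
  assumes ex: "exact_at C f g" and f: "f \<in> Hom C a b" and m: "is_kernel C g m"
    and t: "t \<in> Hom C b x" "t \<cdot> f = Zero C a x"
  shows "t \<cdot> m = Zero C (Dom C m) x"
proof -
  obtain n e where n: "is_kernel C g n" "g \<in> Hom C b (Cod C g)" "n \<in> Hom C (Dom C n) b"
    and e: "e \<in> Hom C a (Dom C n)" "n \<cdot> e = f" "is_epi C e" using exact_atE[OF ex f] by metis
  have "t \<cdot> n \<cdot> e = Zero C a x" using comp_assoc[OF e(1) n(3) t(1)] e(2) t(2) by simp
  then have tn: "t \<cdot> n = Zero C (Dom C n) x"
    using epi_zero[OF e(3,1) comp_hom[OF n(3) t(1)]] by blast
  obtain y where y: "y \<in> Hom C (Dom C m) (Dom C n)" "n \<cdot> y = m"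
    using kernel_lift[OF n(1,2) kernelD[OF m n(2)]] .
  show ?thesis
    using comp_assoc[OF y(1) n(3) t(1)] y(2) tn zero_comp_left[OF y(1)] HomD[OF t(1)] by simp
qed

text \<open>An epimorphism is the cokernel of its kernel. This lemma and the next one are the two reasons
  why an arrow that kills \<open>f\<close> may factor through \<open>g\<close>.\<close>
lemma exact_epi_descend:
  assumes ex: "exact_at C f g" and f: "f \<in> Hom C a b" and epi: "is_epi C g"
    and t: "t \<in> Hom C b x" "t \<cdot> f = Zero C a x"
  obtains s where "s \<in> Hom C (Cod C g) x" and "s \<cdot> g = t"
proof -
  have g: "g \<in> Hom C b (Cod C g)" using exact_at_composite[OF ex f] by blast
  obtain m where m: "is_kernel C g m" using ex_kernel HomD(1)[OF g] by blast
  note mm = kernelD[OF m g]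
  obtain h where h: "is_cokernel C h g" using epi_normal epi by blast
  then have hh: "h \<in> Hom C (Dom C h) b"
    using HomD[OF g] unfolding is_cokernel_def Hom_def by auto
  obtain y where y: "y \<in> Hom C (Dom C h) (Dom C m)" "m \<cdot> y = h"
    using kernel_lift[OF m g hh cokernelD(2)[OF h hh]] .
  have "t \<cdot> h = Zero C (Dom C h) x"
    using comp_assoc[OF y(1) mm(1) t(1)] y(2) exact_at_kernel_zero[OF ex f m t]
      zero_comp_left[OF y(1)] HomD[OF t(1)] by simp
  then show thesis using cokernel_descend[OF h hh t(1)] that by blast
qed

text \<open>The arrow \<open>t\<close> factors through the coimage of \<open>g\<close>, which is a subobject of the codomain of
  \<open>g\<close>; the injectivity of \<open>x\<close> extends the factor to this codomain.\<close>
lemma exact_injective_descend: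
  assumes ex: "exact_at C f g" and f: "f \<in> Hom C a b" and inj: "injective_object C x"
    and t: "t \<in> Hom C b x" "t \<cdot> f = Zero C a x"
  obtains s where "s \<in> Hom C (Cod C g) x" and "s \<cdot> g = t"
proof -
  have g: "g \<in> Hom C b (Cod C g)" using exact_at_composite[OF ex f] by blast
  obtain m where m: "is_kernel C g m" using ex_kernel HomD(1)[OF g] by blast
  note mm = kernelD[OF m g]
  obtain c where c: "is_cokernel C m c" using ex_cokernel HomD(1)[OF mm(1)] by blast
  note ch = cokernelD[OF c mm(1)]
  obtain j where j: "j \<in> Hom C (Cod C c) (Cod C g)" "j \<cdot> c = g"
    using cokernel_descend[OF c mm(1) g mm(2)] .
  have jm: "is_mono C j" using coimage_factor_mono[OF g m c j] .
  obtain u where u: "u \<in> Hom C (Cod C c) x" "u \<cdot> c = t"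
    using cokernel_descend[OF c mm(1) t(1) exact_at_kernel_zero[OF ex f m t]] .
  obtain s where s: "s \<in> Hom C (Cod C g) x" "s \<cdot> j = u"
    using inj jm u(1) HomD[OF j(1)] unfolding injective_object_def by metis
  have "s \<cdot> g = t" using comp_assoc[OF ch(1) j(1) s(1)] j s u by simp
  then show thesis using that s by blast
qed

end

section \<open>Functors induced on kernels\<close>

locale abelian_functor = additive_functor A B F + A: abelian_category A + B: abelian_category B
  for A :: "('o, 'm, 'x) preadd_cat_scheme" and B :: "('p, 'n, 'y) preadd_cat_scheme"
    and F :: "('o, 'm, 'p, 'n) cfunctor"
begin

lemma on_zero:
  assumes a: "a \<in> Obj A" and b: "b \<in> Obj A"
  shows "on_arr F (Zero A a b) = Zero B (on_obj F a) (on_obj F b)"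
proof -
  have "on_arr F \<one>\<^bsub>hom_group A a b\<^esub> = \<one>\<^bsub>hom_group B (on_obj F a) (on_obj F b)\<^esub>"
    using additive[OF a b] A.hom_comm_group[OF a b, THEN comm_group.axioms(2)]
      B.hom_comm_group[OF on_obj[OF a] on_obj[OF b], THEN comm_group.axioms(2)]
    by (rule hom_one)
  then show ?thesis by (simp add: hom_group_def)
qed

lemma on_plus:
  assumes f: "f \<in> Hom A a b" and g: "g \<in> Hom A a b"
  shows "on_arr F (Plus A f g) = Plus B (on_arr F f) (on_arr F g)"
  using additive[OF A.HomD(4,5)[OF f]] f g unfolding hom_def hom_group_def by auto

end

text \<open>The data common to \<open>C\<^sup>1F\<close> and \<open>R\<^sup>0F\<close>. The condition \<open>descend\<close> supplies the second component
  of the extension of a morphism. It holds for different reasons in the two cases: for a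
  cosyzygy sequence because \<open>d a\<close> is epi, and for an injective copresentation because the
  codomain of \<open>d b\<close> is injective.\<close>
locale injective_copresentations = abelian_functor A B F
  for A :: "('o, 'm, 'x) preadd_cat_scheme" and B :: "('p, 'n, 'y) preadd_cat_scheme"
    and F :: "('o, 'm, 'p, 'n) cfunctor" +
  fixes i d :: "'o \<Rightarrow> 'm"
  assumes start: "a \<in> Obj A \<Longrightarrow> Dom A (i a) = a"
    and left_exact: "a \<in> Obj A \<Longrightarrow> left_exact_seq A (i a) (d a)"
    and injective: "a \<in> Obj A \<Longrightarrow> injective_object A (Cod A (i a))"
    and descend: "\<lbrakk>a \<in> Obj A; b \<in> Obj A; t \<in> Hom A (Cod A (i a)) (Cod A (d b));
        t \<cdot>\<^bsub>A\<^esub> i a = Zero A a (Cod A (d b))\<rbrakk>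
      \<Longrightarrow> \<exists>s \<in> Hom A (Cod A (d a)) (Cod A (d b)). s \<cdot>\<^bsub>A\<^esub> d a = t"
begin

abbreviation "J a \<equiv> Cod A (i a)"
abbreviation "K a \<equiv> Cod A (d a)"
abbreviation "\<kappa> a \<equiv> ker B (on_arr F (d a))"
abbreviation "L \<equiv> kernel_extension A B F i d"

definition extension :: "'o \<Rightarrow> 'o \<Rightarrow> 'm \<Rightarrow> 'm \<Rightarrow> 'm \<Rightarrow> bool" where
  "extension a b f g g' \<longleftrightarrow> g \<in> Hom A (J a) (J b) \<and> g' \<in> Hom A (K a) (K b) \<and>
    g \<cdot>\<^bsub>A\<^esub> i a = i b \<cdot>\<^bsub>A\<^esub> f \<and> g' \<cdot>\<^bsub>A\<^esub> d a = d b \<cdot>\<^bsub>A\<^esub> g"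

lemma copresentation:
  assumes a: "a \<in> Obj A"
  shows "i a \<in> Hom A a (J a)" and "d a \<in> Hom A (J a) (K a)" and "is_mono A (i a)"
    and "d a \<cdot>\<^bsub>A\<^esub> i a = Zero A a (K a)" and "exact_at A (i a) (d a)"
  using A.left_exact_hom[OF left_exact[OF a]] A.left_exact_mono[OF left_exact[OF a]]
    left_exact[OF a] start[OF a] unfolding left_exact_seq_def by simp_all

lemma kernel_arrow:
  assumes a: "a \<in> Obj A"
  shows "is_kernel B (on_arr F (d a)) (\<kappa> a)"
    and "\<kappa> a \<in> Hom B (on_obj L a) (on_obj F (J a))" and "is_mono B (\<kappa> a)"
    and "on_arr F (d a) \<cdot>\<^bsub>B\<^esub> \<kappa> a = Zero B (on_obj L a) (on_obj F (K a))"
proof -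
  note Fd = on_arr[OF copresentation(2)[OF a]]
  show k: "is_kernel B (on_arr F (d a)) (\<kappa> a)" using B.ker_is_kernel[OF Fd] .
  show "\<kappa> a \<in> Hom B (on_obj L a) (on_obj F (J a))" "is_mono B (\<kappa> a)"
    "on_arr F (d a) \<cdot>\<^bsub>B\<^esub> \<kappa> a = Zero B (on_obj L a) (on_obj F (K a))"
    using B.kernelD[OF k Fd] B.kernel_mono[OF k] by (simp_all add: kernel_extension_def)
qed

lemma kernel_arrow_lift:
  assumes a: "a \<in> Obj A" and x: "x \<in> Hom B y (on_obj F (J a))"
    and zero: "on_arr F (d a) \<cdot>\<^bsub>B\<^esub> x = Zero B y (on_obj F (K a))"
  obtains h where "h \<in> Hom B y (on_obj L a)" and "\<kappa> a \<cdot>\<^bsub>B\<^esub> h = x"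
proof -
  obtain h where "h \<in> Hom B y (Dom B (\<kappa> a))" "\<kappa> a \<cdot>\<^bsub>B\<^esub> h = x"
    using B.kernel_lift[OF kernel_arrow(1)[OF a] on_arr[OF copresentation(2)[OF a]] x zero] .
  then show thesis using that B.HomD(2)[OF kernel_arrow(2)[OF a]] by simp
qed

lemma extend_to_injective:
  assumes a: "a \<in> Obj A" and x: "injective_object A x" and f: "f \<in> Hom A a x"
  obtains g where "g \<in> Hom A (J a) x" and "g \<cdot>\<^bsub>A\<^esub> i a = f"
proof -
  have "f \<in> Hom A (Dom A (i a)) x" using f start[OF a] by simp
  then show thesis
    using x copresentation(3)[OF a] that unfolding injective_object_def by blast
qed

lemma ex_extension:
  assumes f: "f \<in> Hom A a b"
  obtains g g' where "extension a b f g g'"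
proof -
  have a: "a \<in> Obj A" and b: "b \<in> Obj A" using A.HomD[OF f] by blast+
  obtain g where g: "g \<in> Hom A (J a) (J b)" "g \<cdot>\<^bsub>A\<^esub> i a = i b \<cdot>\<^bsub>A\<^esub> f"
    using extend_to_injective[OF a injective[OF b] A.comp_hom[OF f copresentation(1)[OF b]]] .
  have "d b \<cdot>\<^bsub>A\<^esub> g \<cdot>\<^bsub>A\<^esub> i a = d b \<cdot>\<^bsub>A\<^esub> i b \<cdot>\<^bsub>A\<^esub> f"
    using A.comp_assoc[OF copresentation(1)[OF a] g(1) copresentation(2)[OF b]] g(2)
      A.comp_assoc[OF f copresentation(1,2)[OF b]] by simp
  also have "\<dots> = Zero A a (K b)"
    using copresentation(4)[OF b] A.zero_comp_left[OF f] A.HomD(5)[OF copresentation(2)[OF b]]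
    by simp
  finally obtain g' where "g' \<in> Hom A (K a) (K b)" "g' \<cdot>\<^bsub>A\<^esub> d a = d b \<cdot>\<^bsub>A\<^esub> g"
    using descend[OF a b A.comp_hom[OF g(1) copresentation(2)[OF b]]] by blast
  then show thesis using that g unfolding extension_def by blast
qed

lemma extension_idn:
  assumes a: "a \<in> Obj A"
  shows "extension a a (Idn A a) (Idn A (J a)) (Idn A (K a))"
proof -
  note ia = copresentation(1,2)[OF a]
  have "J a \<in> Obj A" "K a \<in> Obj A" using A.HomD[OF ia(2)] by blast+
  then show ?thesis
    unfolding extension_def
    using A.idn_hom A.comp_idn[OF ia(1)] A.idn_comp[OF ia(1)] A.comp_idn[OF ia(2)]
      A.idn_comp[OF ia(2)] by simp
qed

lemma extension_comp:
  assumes f: "f \<in> Hom A a b" and h: "h \<in> Hom A b c"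
    and e: "extension a b f g g'" and e': "extension b c h k k'"
  shows "extension a c (h \<cdot>\<^bsub>A\<^esub> f) (k \<cdot>\<^bsub>A\<^esub> g) (k' \<cdot>\<^bsub>A\<^esub> g')"
proof -
  have abc: "a \<in> Obj A" "b \<in> Obj A" "c \<in> Obj A" using A.HomD f h by blast+
  note ia = copresentation(1,2)[OF abc(1)] and ib = copresentation(1,2)[OF abc(2)]
    and ic = copresentation(1,2)[OF abc(3)]
  have g: "g \<in> Hom A (J a) (J b)" "g' \<in> Hom A (K a) (K b)"
      "g \<cdot>\<^bsub>A\<^esub> i a = i b \<cdot>\<^bsub>A\<^esub> f" "g' \<cdot>\<^bsub>A\<^esub> d a = d b \<cdot>\<^bsub>A\<^esub> g"
    using e unfolding extension_def by blast+
  have k: "k \<in> Hom A (J b) (J c)" "k' \<in> Hom A (K b) (K c)"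
      "k \<cdot>\<^bsub>A\<^esub> i b = i c \<cdot>\<^bsub>A\<^esub> h" "k' \<cdot>\<^bsub>A\<^esub> d b = d c \<cdot>\<^bsub>A\<^esub> k"
    using e' unfolding extension_def by blast+
  have "k \<cdot>\<^bsub>A\<^esub> g \<cdot>\<^bsub>A\<^esub> i a = i c \<cdot>\<^bsub>A\<^esub> (h \<cdot>\<^bsub>A\<^esub> f)"
    using A.comp_assoc[OF ia(1) g(1) k(1)] A.comp_assoc[OF f ib(1) k(1)]
      A.comp_assoc[OF f h ic(1)] g(3) k(3) by simp
  moreover have "k' \<cdot>\<^bsub>A\<^esub> g' \<cdot>\<^bsub>A\<^esub> d a = d c \<cdot>\<^bsub>A\<^esub> (k \<cdot>\<^bsub>A\<^esub> g)"
    using A.comp_assoc[OF ia(2) g(2) k(2)] A.comp_assoc[OF g(1) ib(2) k(2)]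
      A.comp_assoc[OF g(1) k(1) ic(2)] g(4) k(4) by simp
  ultimately show ?thesis
    unfolding extension_def using A.comp_hom[OF g(1) k(1)] A.comp_hom[OF g(2) k(2)] by blast
qed

text \<open>The difference of \<open>g\<close> and \<open>h\<close> kills \<open>i a\<close>, hence equals \<open>s \<cdot> d a\<close> for some \<open>s\<close>; and
  \<open>F(s) \<cdot> F(d a)\<close> vanishes on the kernel of \<open>F(d a)\<close>. This makes the map induced on the
  kernels independent of the extension.\<close>
lemma extensions_agree_on_kernel:
  assumes a: "a \<in> Obj A" and x: "injective_object A x"
    and g: "g \<in> Hom A (J a) x" and h: "h \<in> Hom A (J a) x"
    and eq: "g \<cdot>\<^bsub>A\<^esub> i a = h \<cdot>\<^bsub>A\<^esub> i a"
  shows "on_arr F g \<cdot>\<^bsub>B\<^esub> \<kappa> a = on_arr F h \<cdot>\<^bsub>B\<^esub> \<kappa> a"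
proof -
  note ia = copresentation[OF a] and ka = kernel_arrow[OF a]
  obtain t where t: "t \<in> Hom A (J a) x" "g = Plus A t h" "t \<cdot>\<^bsub>A\<^esub> i a = Zero A a x"
    using A.precomp_difference[OF ia(1) g h eq] .
  obtain s where s: "s \<in> Hom A (K a) x" "s \<cdot>\<^bsub>A\<^esub> d a = t"
    using A.exact_injective_descend[OF ia(5,1) x t(1,3)] .
  have "on_arr F t \<cdot>\<^bsub>B\<^esub> \<kappa> a = on_arr F s \<cdot>\<^bsub>B\<^esub> (on_arr F (d a) \<cdot>\<^bsub>B\<^esub> \<kappa> a)"
    using B.comp_assoc[OF ka(2) on_arr[OF ia(2)] on_arr[OF s(1)]] on_comp[OF ia(2) s(1)] s(2)
    by simp
  also have "\<dots> = Zero B (on_obj L a) (on_obj F x)"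
    using ka(4) B.zero_comp_right[OF on_arr[OF s(1)]] B.HomD[OF ka(2)] by simp
  finally have "Plus B (on_arr F t \<cdot>\<^bsub>B\<^esub> \<kappa> a) (on_arr F h \<cdot>\<^bsub>B\<^esub> \<kappa> a) = on_arr F h \<cdot>\<^bsub>B\<^esub> \<kappa> a"
    using B.zero_plus[OF B.comp_hom[OF ka(2) on_arr[OF h]]] by simp
  then show ?thesis
    using on_plus[OF t(1) h] t(2) B.plus_comp[OF ka(2) on_arr[OF t(1)] on_arr[OF h]] by simp
qed

text \<open>Turns the definite description in \<open>kernel_extension\<close> into a criterion: any extension whatever
  determines the value on \<open>f\<close>.\<close>
lemma on_arr_L_eq:
  assumes f: "f \<in> Hom A a b" and e: "extension a b f g g'"
    and h: "h \<in> Hom B (on_obj L a) (on_obj L b)" "\<kappa> b \<cdot>\<^bsub>B\<^esub> h = on_arr F g \<cdot>\<^bsub>B\<^esub> \<kappa> a"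
  shows "on_arr L f = h"
proof -
  have ab: "a \<in> Obj A" "b \<in> Obj A" using A.HomD[OF f] by blast+
  let ?P = "\<lambda>h. h \<in> Hom B (on_obj L a) (on_obj L b) \<and>
    (\<exists>g \<in> Hom A (J a) (J b). \<exists>g' \<in> Hom A (K a) (K b).
      g \<cdot>\<^bsub>A\<^esub> i a = i b \<cdot>\<^bsub>A\<^esub> f \<and> g' \<cdot>\<^bsub>A\<^esub> d a = d b \<cdot>\<^bsub>A\<^esub> g \<and>
      \<kappa> b \<cdot>\<^bsub>B\<^esub> h = on_arr F g \<cdot>\<^bsub>B\<^esub> \<kappa> a)"
  have L: "on_arr L f = (THE h. ?P h)"
    using A.HomD[OF f] by (simp add: kernel_extension_def Let_def)
  have "?P h" using e h unfolding extension_def by blast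
  moreover have "h' = h" if h': "?P h'" for h'
  proof -
    obtain k where k: "k \<in> Hom A (J a) (J b)" "k \<cdot>\<^bsub>A\<^esub> i a = i b \<cdot>\<^bsub>A\<^esub> f"
        "\<kappa> b \<cdot>\<^bsub>B\<^esub> h' = on_arr F k \<cdot>\<^bsub>B\<^esub> \<kappa> a" using h' by blast
    have g: "g \<in> Hom A (J a) (J b)" "g \<cdot>\<^bsub>A\<^esub> i a = i b \<cdot>\<^bsub>A\<^esub> f"
      using e unfolding extension_def by blast+
    have "on_arr F k \<cdot>\<^bsub>B\<^esub> \<kappa> a = on_arr F g \<cdot>\<^bsub>B\<^esub> \<kappa> a"
      using extensions_agree_on_kernel[OF ab(1) injective[OF ab(2)] k(1) g(1)] k(2) g(2) by metis
    then have "\<kappa> b \<cdot>\<^bsub>B\<^esub> h' = \<kappa> b \<cdot>\<^bsub>B\<^esub> h" using k(3) h(2) by metis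
    then show ?thesis using B.mono_cancel[OF kernel_arrow(3,2)[OF ab(2)]] h' h(1) by blast
  qed
  ultimately show ?thesis unfolding L by (rule the_equality)
qed

lemma on_arr_LE:
  assumes f: "f \<in> Hom A a b"
  obtains g g' where "extension a b f g g'"
    and "on_arr L f \<in> Hom B (on_obj L a) (on_obj L b)"
    and "\<kappa> b \<cdot>\<^bsub>B\<^esub> on_arr L f = on_arr F g \<cdot>\<^bsub>B\<^esub> \<kappa> a"
proof -
  have ab: "a \<in> Obj A" "b \<in> Obj A" using A.HomD[OF f] by blast+
  note da = copresentation(2)[OF ab(1)] and db = copresentation(2)[OF ab(2)]
    and ka = kernel_arrow[OF ab(1)]
  obtain g g' where e: "extension a b f g g'" using ex_extension[OF f] .
  then have g: "g \<in> Hom A (J a) (J b)" "g' \<in> Hom A (K a) (K b)" "g' \<cdot>\<^bsub>A\<^esub> d a = d b \<cdot>\<^bsub>A\<^esub> g"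
    unfolding extension_def by blast+
  have "on_arr F (d b) \<cdot>\<^bsub>B\<^esub> (on_arr F g \<cdot>\<^bsub>B\<^esub> \<kappa> a) = on_arr F g' \<cdot>\<^bsub>B\<^esub> (on_arr F (d a) \<cdot>\<^bsub>B\<^esub> \<kappa> a)"
    using B.comp_assoc[OF ka(2) on_arr[OF g(1)] on_arr[OF db]]
      B.comp_assoc[OF ka(2) on_arr[OF da] on_arr[OF g(2)]]
      on_comp[OF g(1) db] on_comp[OF da g(2)] g(3) by simp
  also have "\<dots> = Zero B (on_obj L a) (on_obj F (K b))"
    using ka(4) B.zero_comp_right[OF on_arr[OF g(2)]] B.HomD[OF ka(2)] by simp
  finally obtain h where h: "h \<in> Hom B (on_obj L a) (on_obj L b)"
      "\<kappa> b \<cdot>\<^bsub>B\<^esub> h = on_arr F g \<cdot>\<^bsub>B\<^esub> \<kappa> a"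
    using kernel_arrow_lift[OF ab(2) B.comp_hom[OF ka(2) on_arr[OF g(1)]]] by blast
  then show thesis using that[OF e] on_arr_L_eq[OF f e h] by simp
qed

lemma covariant_functor_L: "covariant_functor A B L"
proof unfold_locales
  fix a assume a: "a \<in> Obj A"
  note ka = kernel_arrow[OF a]
  show La: "on_obj L a \<in> Obj B" using B.HomD[OF ka(2)] by blast
  have "\<kappa> a \<cdot>\<^bsub>B\<^esub> Idn B (on_obj L a) = on_arr F (Idn A (J a)) \<cdot>\<^bsub>B\<^esub> \<kappa> a"
    using B.comp_idn[OF ka(2)] B.idn_comp[OF ka(2)] on_idn A.HomD[OF copresentation(1)[OF a]]
    by simp
  then show "on_arr L (Idn A a) = Idn B (on_obj L a)"
    using on_arr_L_eq[OF A.idn_hom[OF a] extension_idn[OF a] B.idn_hom[OF La]] by blast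
next
  fix f a b assume "f \<in> Hom A a b"
  then show "on_arr L f \<in> Hom B (on_obj L a) (on_obj L b)" using on_arr_LE by blast
next
  fix f a b h c assume f: "f \<in> Hom A a b" and h: "h \<in> Hom A b c"
  have abc: "a \<in> Obj A" "b \<in> Obj A" "c \<in> Obj A" using A.HomD f h by blast+
  note ka = kernel_arrow(2)[OF abc(1)] and kb = kernel_arrow(2)[OF abc(2)]
    and kc = kernel_arrow(2)[OF abc(3)]
  obtain g g' where e: "extension a b f g g'"
    and Lf: "on_arr L f \<in> Hom B (on_obj L a) (on_obj L b)"
      "\<kappa> b \<cdot>\<^bsub>B\<^esub> on_arr L f = on_arr F g \<cdot>\<^bsub>B\<^esub> \<kappa> a" using on_arr_LE[OF f] .
  obtain k k' where e': "extension b c h k k'"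
    and Lh: "on_arr L h \<in> Hom B (on_obj L b) (on_obj L c)"
      "\<kappa> c \<cdot>\<^bsub>B\<^esub> on_arr L h = on_arr F k \<cdot>\<^bsub>B\<^esub> \<kappa> b" using on_arr_LE[OF h] .
  have g: "g \<in> Hom A (J a) (J b)" and k: "k \<in> Hom A (J b) (J c)"
    using e e' unfolding extension_def by blast+
  have "\<kappa> c \<cdot>\<^bsub>B\<^esub> (on_arr L h \<cdot>\<^bsub>B\<^esub> on_arr L f) = on_arr F (k \<cdot>\<^bsub>A\<^esub> g) \<cdot>\<^bsub>B\<^esub> \<kappa> a"
    using B.comp_assoc[OF Lf(1) Lh(1) kc] B.comp_assoc[OF Lf(1) kb on_arr[OF k]]
      B.comp_assoc[OF ka on_arr[OF g] on_arr[OF k]] on_comp[OF g k] Lf(2) Lh(2) by simp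
  then show "on_arr L (h \<cdot>\<^bsub>A\<^esub> f) = on_arr L h \<cdot>\<^bsub>B\<^esub> on_arr L f"
    using on_arr_L_eq[OF A.comp_hom[OF f h] extension_comp[OF f h e e']
        B.comp_hom[OF Lf(1) Lh(1)]] by blast
qed

lemma rho_hom:
  assumes a: "a \<in> Obj A"
  shows "rho A B F i d a \<in> Hom B (on_obj F a) (on_obj L a)"
    and "\<kappa> a \<cdot>\<^bsub>B\<^esub> rho A B F i d a = on_arr F (i a)"
proof -
  note ia = copresentation[OF a]
  have "on_arr F (d a) \<cdot>\<^bsub>B\<^esub> on_arr F (i a) = Zero B (on_obj F a) (on_obj F (K a))"
    using on_comp[OF ia(1,2)] ia(4) on_zero a A.HomD[OF ia(2)] by simp
  then obtain h where h: "h \<in> Hom B (on_obj F a) (on_obj L a)" "\<kappa> a \<cdot>\<^bsub>B\<^esub> h = on_arr F (i a)"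
    using kernel_arrow_lift[OF a on_arr[OF ia(1)]] by blast
  then have "\<exists>!h. h \<in> Hom B (on_obj F a) (on_obj L a) \<and> \<kappa> a \<cdot>\<^bsub>B\<^esub> h = on_arr F (i a)"
    using B.mono_cancel[OF kernel_arrow(3,2)[OF a]] by metis
  from theI'[OF this]
  show "rho A B F i d a \<in> Hom B (on_obj F a) (on_obj L a)"
    "\<kappa> a \<cdot>\<^bsub>B\<^esub> rho A B F i d a = on_arr F (i a)"
    unfolding rho_def right_derived0_def by blast+
qed

text \<open>For a cosyzygy choice the transformation \<open>rho A B F i d\<close> is the map \<open>\<epsilon>\<close> from \<open>F\<close> to its right
  cosatellite.\<close>
lemma rho_natural: "natural_transformation A B F L (rho A B F i d)"
proof -
  interpret L: covariant_functor A B L by (rule covariant_functor_L)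
  show ?thesis
  proof unfold_locales
    fix a assume "a \<in> Obj A"
    then show "rho A B F i d a \<in> Hom B (on_obj F a) (on_obj L a)" by (rule rho_hom)
  next
    fix f a b assume f: "f \<in> Hom A a b"
    have ab: "a \<in> Obj A" "b \<in> Obj A" using A.HomD[OF f] by blast+
    note ia = copresentation(1)[OF ab(1)] and ib = copresentation(1)[OF ab(2)]
      and ka = kernel_arrow[OF ab(1)] and kb = kernel_arrow[OF ab(2)]
      and ra = rho_hom[OF ab(1)] and rb = rho_hom[OF ab(2)] and Ff = on_arr[OF f]
    obtain g g' where "extension a b f g g'"
      and Lf: "on_arr L f \<in> Hom B (on_obj L a) (on_obj L b)"
        "\<kappa> b \<cdot>\<^bsub>B\<^esub> on_arr L f = on_arr F g \<cdot>\<^bsub>B\<^esub> \<kappa> a" using on_arr_LE[OF f] .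
    then have g: "g \<in> Hom A (J a) (J b)" "g \<cdot>\<^bsub>A\<^esub> i a = i b \<cdot>\<^bsub>A\<^esub> f"
      unfolding extension_def by blast+
    have "\<kappa> b \<cdot>\<^bsub>B\<^esub> (rho A B F i d b \<cdot>\<^bsub>B\<^esub> on_arr F f) = on_arr F (i b \<cdot>\<^bsub>A\<^esub> f)"
      using B.comp_assoc[OF Ff rb(1) kb(2)] rb(2) on_comp[OF f ib] by simp
    also have "\<dots> = on_arr F g \<cdot>\<^bsub>B\<^esub> (\<kappa> a \<cdot>\<^bsub>B\<^esub> rho A B F i d a)"
      using g(2) on_comp[OF ia g(1)] ra(2) by simp
    also have "\<dots> = \<kappa> b \<cdot>\<^bsub>B\<^esub> (on_arr L f \<cdot>\<^bsub>B\<^esub> rho A B F i d a)"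
      using B.comp_assoc[OF ra(1) ka(2) on_arr[OF g(1)]] B.comp_assoc[OF ra(1) Lf(1) kb(2)] Lf(2)
      by simp
    finally show "rho A B F i d b \<cdot>\<^bsub>B\<^esub> on_arr F f = on_arr L f \<cdot>\<^bsub>B\<^esub> rho A B F i d a"
      using B.mono_cancel[OF kb(3,2) B.comp_hom[OF Ff rb(1)] B.comp_hom[OF ra(1) Lf(1)]] by blast
  qed
qed

text \<open>The map \<open>rho\<close> is the factor of \<open>F(i a)\<close> through the kernel of \<open>F(d a)\<close>. Exactness says that
  this kernel is also the image of \<open>F(i a)\<close>, and a map factors through its image by an
  epimorphism.\<close>
lemma rho_epi:
  assumes a: "a \<in> Obj A" and ex: "exact_at B (on_arr F (i a)) (on_arr F (d a))"
  shows "is_epi B (rho A B F i d a)"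
proof -
  note ia = copresentation[OF a] and ka = kernel_arrow[OF a] and ra = rho_hom[OF a]
  note Fi = on_arr[OF ia(1)]
  obtain m e where m: "is_image B (on_arr F (i a)) m" "is_kernel B (on_arr F (d a)) m"
    and mh: "m \<in> Hom B (Dom B m) (on_obj F (J a))"
    using B.exact_atE[OF ex Fi] by metis
  obtain c where c: "is_cokernel B (on_arr F (i a)) c" "c \<in> Hom B (on_obj F (J a)) (Cod B c)"
    using B.imageE[OF m(1) Fi] by metis
  \<comment> \<open>The cokernel of \<open>F(i a)\<close> and \<open>F(d a)\<close> kill the same arrows, so they share their kernel.\<close>
  have "is_kernel B c (\<kappa> a)"
  proof (rule B.kernelI_mono[OF c(2) ka(3,2)])
    show "c \<cdot>\<^bsub>B\<^esub> \<kappa> a = Zero B (on_obj L a) (Cod B c)"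
      using B.exact_at_kernel_zero[OF ex Fi ka(1) c(2) B.cokernelD(2)[OF c(1) Fi]] B.HomD[OF ka(2)]
      by simp
  next
    fix x u assume u: "u \<in> Hom B x (on_obj F (J a))" "c \<cdot>\<^bsub>B\<^esub> u = Zero B x (Cod B c)"
    have Fd: "on_arr F (d a) \<in> Hom B (on_obj F (J a)) (on_obj F (K a))" using on_arr[OF ia(2)] .
    have "on_arr F (d a) \<cdot>\<^bsub>B\<^esub> on_arr F (i a) = Zero B (on_obj F a) (on_obj F (K a))"
      using B.exact_at_composite[OF ex Fi] B.HomD[OF Fd] by simp
    then obtain y where y: "y \<in> Hom B (Cod B c) (on_obj F (K a))" "y \<cdot>\<^bsub>B\<^esub> c = on_arr F (d a)"
      using B.cokernel_descend[OF c(1) Fi Fd] by blast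
    have "on_arr F (d a) \<cdot>\<^bsub>B\<^esub> u = Zero B x (on_obj F (K a))"
      using B.comp_assoc[OF u(1) c(2) y(1)] y u(2) B.zero_comp_right[OF y(1)] B.HomD[OF u(1)]
      by simp
    then show "\<exists>h \<in> Hom B x (on_obj L a). \<kappa> a \<cdot>\<^bsub>B\<^esub> h = u"
      using kernel_arrow_lift[OF a u(1)] by blast
  qed
  then have "is_image B (on_arr F (i a)) (\<kappa> a)" using c(1) unfolding is_image_def by blast
  moreover have "rho A B F i d a \<in> Hom B (on_obj F a) (Dom B (\<kappa> a))"
    using ra(1) B.HomD[OF ka(2)] by simp
  ultimately show ?thesis using B.image_factor_epi[OF _ Fi _ ra(2)] by blast
qed

end

section \<open>Comparing two choices\<close>

text \<open>Injectivity gives \<open>u\<close> and \<open>w\<close> with \<open>u \<cdot> i = j\<close> and \<open>w \<cdot> j = i\<close>. With \<open>n = F(u) \<cdot> \<kappa>\<close>,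
  composing with the epimorphism \<open>\<epsilon> = rho A B F i d a\<close> gives \<open>F(j)\<close>. This shows that \<open>F(e) \<cdot> n\<close>
  vanishes, so that \<open>n\<close> restricts to a map \<open>\<theta>\<close> into \<open>ker F(e)\<close>. It also shows
  \<open>F(w) \<cdot> n = \<kappa>\<close>, and \<open>\<kappa>\<close> is mono, so \<open>\<theta>\<close> is mono.\<close>
lemma rho_comparison:
  assumes P: "injective_copresentations A B F i d" and Q: "injective_copresentations A B F j e"
    and a: "a \<in> Obj A" and epi: "is_epi B (rho A B F i d a)"
  obtains \<theta> where
    "\<theta> \<in> Hom B (on_obj (kernel_extension A B F i d) a) (on_obj (kernel_extension A B F j e) a)"
    "is_mono B \<theta>" "\<theta> \<cdot>\<^bsub>B\<^esub> rho A B F i d a = rho A B F j e a"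
proof -
  interpret P: injective_copresentations A B F i d by (rule P)
  interpret Q: injective_copresentations A B F j e by (rule Q)
  note Pi = P.copresentation[OF a] and Pk = P.kernel_arrow[OF a] and Pr = P.rho_hom[OF a]
    and Qi = Q.copresentation[OF a] and Qk = Q.kernel_arrow[OF a] and Qr = Q.rho_hom[OF a]
  obtain u where u: "u \<in> Hom A (P.J a) (Q.J a)" "u \<cdot>\<^bsub>A\<^esub> i a = j a"
    using P.extend_to_injective[OF a Q.injective[OF a] Qi(1)] .
  obtain w where w: "w \<in> Hom A (Q.J a) (P.J a)" "w \<cdot>\<^bsub>A\<^esub> j a = i a"
    using Q.extend_to_injective[OF a P.injective[OF a] Pi(1)] .
  \<comment> \<open>The two monomorphisms out of \<open>a\<close> have injective targets, so each extends along the other.\<close>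
  note Fu = P.on_arr[OF u(1)] and Fw = P.on_arr[OF w(1)] and Fe = P.on_arr[OF Qi(2)]
  let ?n = "on_arr F u \<cdot>\<^bsub>B\<^esub> P.\<kappa> a"
  have n: "?n \<in> Hom B (on_obj P.L a) (on_obj F (Q.J a))" using P.B.comp_hom[OF Pk(2) Fu] .
  have n_rho: "?n \<cdot>\<^bsub>B\<^esub> rho A B F i d a = on_arr F (j a)"
    using P.B.comp_assoc[OF Pr(1) Pk(2) Fu] Pr(2) P.on_comp[OF Pi(1) u(1)] u(2) by simp
  have "on_arr F (e a) \<cdot>\<^bsub>B\<^esub> ?n \<cdot>\<^bsub>B\<^esub> rho A B F i d a = on_arr F (e a \<cdot>\<^bsub>A\<^esub> j a)"
    using P.B.comp_assoc[OF Pr(1) n Fe] n_rho P.on_comp[OF Qi(1,2)] by simp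
  also have "\<dots> = Zero B (on_obj F a) (on_obj F (Q.K a))"
    using Qi(4) P.on_zero a P.A.HomD[OF Qi(2)] by simp
  finally have "on_arr F (e a) \<cdot>\<^bsub>B\<^esub> ?n = Zero B (on_obj P.L a) (on_obj F (Q.K a))"
    using P.B.epi_zero[OF epi Pr(1) P.B.comp_hom[OF n Fe]] by blast
  then obtain \<theta> where \<theta>: "\<theta> \<in> Hom B (on_obj P.L a) (on_obj Q.L a)" "Q.\<kappa> a \<cdot>\<^bsub>B\<^esub> \<theta> = ?n"
    using Q.kernel_arrow_lift[OF a n] by blast
  have "on_arr F w \<cdot>\<^bsub>B\<^esub> ?n \<cdot>\<^bsub>B\<^esub> rho A B F i d a = P.\<kappa> a \<cdot>\<^bsub>B\<^esub> rho A B F i d a"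
    using P.B.comp_assoc[OF Pr(1) n Fw] n_rho P.on_comp[OF Qi(1) w(1)] w(2) Pr(2) by simp
  then have wn: "on_arr F w \<cdot>\<^bsub>B\<^esub> ?n = P.\<kappa> a"
    using P.B.epi_cancel[OF epi Pr(1) P.B.comp_hom[OF n Fw] Pk(2)] by blast
  have "is_mono B \<theta>"
  proof (rule P.B.monoI_zero[OF \<theta>(1)])
    fix x t assume t: "t \<in> Hom B x (on_obj P.L a)" "\<theta> \<cdot>\<^bsub>B\<^esub> t = Zero B x (on_obj Q.L a)"
    have x: "x \<in> Obj B" using P.B.HomD[OF t(1)] by blast
    have "?n \<cdot>\<^bsub>B\<^esub> t = Zero B x (on_obj F (Q.J a))"
      using P.B.comp_assoc[OF t(1) \<theta>(1) Qk(2)] \<theta>(2) t(2) P.B.zero_comp_right[OF Qk(2) x] by simp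
    then have "P.\<kappa> a \<cdot>\<^bsub>B\<^esub> t = Zero B x (on_obj F (P.J a))"
      using P.B.comp_assoc[OF t(1) n Fw] wn P.B.zero_comp_right[OF Fw x] by simp
    then show "t = Zero B x (on_obj P.L a)" using P.B.mono_zero[OF Pk(3,2) t(1)] by blast
  qed
  moreover have "\<theta> \<cdot>\<^bsub>B\<^esub> rho A B F i d a = rho A B F j e a"
  proof -
    have "Q.\<kappa> a \<cdot>\<^bsub>B\<^esub> (\<theta> \<cdot>\<^bsub>B\<^esub> rho A B F i d a) = Q.\<kappa> a \<cdot>\<^bsub>B\<^esub> rho A B F j e a"
      using P.B.comp_assoc[OF Pr(1) \<theta>(1) Qk(2)] \<theta>(2) n_rho Qr(2) by metis
    then show ?thesis
      using P.B.mono_cancel[OF Qk(3,2) P.B.comp_hom[OF Pr(1) \<theta>(1)] Qr(1)] by blast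
  qed
  ultimately show thesis using that \<theta>(1) by blast
qed

section \<open>Images of natural transformations\<close>

text \<open>The map \<open>G(f)\<close> carries the image of \<open>\<rho> a\<close> into that of \<open>\<rho> b\<close>: the cokernel of \<open>\<rho> b\<close>
  kills \<open>G(f) \<cdot> \<rho> a = \<rho> b \<cdot> F(f)\<close>, and \<open>\<rho> a\<close> is an epimorphism followed by its image.\<close>
lemma image_functor_arr:
  assumes B: "abelian_category B" and nat: "natural_transformation A B F G \<rho>"
    and f: "f \<in> Hom A a b"
  shows "on_arr (image_functor A B G \<rho>) f \<in> Hom B (Dom B (img B (\<rho> a))) (Dom B (img B (\<rho> b)))"
    and "img B (\<rho> b) \<cdot>\<^bsub>B\<^esub> on_arr (image_functor A B G \<rho>) f = on_arr G f \<cdot>\<^bsub>B\<^esub> img B (\<rho> a)"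
proof -
  interpret B: abelian_category B by (rule B)
  interpret natural_transformation A B F G \<rho> by (rule nat)
  have ab: "a \<in> Obj A" "b \<in> Obj A" using F.A.HomD[OF f] by blast+
  note ra = component[OF ab(1)] and rb = component[OF ab(2)]
    and Ff = F.on_arr[OF f] and Gf = G.on_arr[OF f]
  note ma = B.img_is_image[OF ra] and mb = B.img_is_image[OF rb]
  note mah = B.imageD[OF ma ra] and mbh = B.imageD[OF mb rb]
  obtain q where q: "q \<in> Hom B (on_obj F a) (Dom B (img B (\<rho> a)))" "img B (\<rho> a) \<cdot>\<^bsub>B\<^esub> q = \<rho> a"
    using B.image_factor[OF ma ra] .
  have qe: "is_epi B q" using B.image_factor_epi[OF ma ra q] .
  obtain c where c: "is_cokernel B (\<rho> b) c" "c \<in> Hom B (on_obj G b) (Cod B c)"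
      "is_kernel B c (img B (\<rho> b))" using B.imageE[OF mb rb] .
  note n = B.comp_hom[OF mah(1) Gf]
  have "c \<cdot>\<^bsub>B\<^esub> (on_arr G f \<cdot>\<^bsub>B\<^esub> img B (\<rho> a)) \<cdot>\<^bsub>B\<^esub> q = c \<cdot>\<^bsub>B\<^esub> \<rho> b \<cdot>\<^bsub>B\<^esub> on_arr F f"
    using B.comp_assoc[OF q(1) n c(2)] B.comp_assoc[OF q(1) mah(1) Gf] q(2) naturality[OF f]
      B.comp_assoc[OF Ff rb c(2)] by simp
  also have "\<dots> = Zero B (on_obj F a) (Cod B c)"
    using B.cokernelD(2)[OF c(1) rb] B.zero_comp_left[OF Ff] B.HomD[OF c(2)] by simp
  finally have "c \<cdot>\<^bsub>B\<^esub> (on_arr G f \<cdot>\<^bsub>B\<^esub> img B (\<rho> a)) = Zero B (Dom B (img B (\<rho> a))) (Cod B c)"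
    using B.epi_zero[OF qe q(1) B.comp_hom[OF n c(2)]] by blast
  then obtain h where "h \<in> Hom B (Dom B (img B (\<rho> a))) (Dom B (img B (\<rho> b)))"
      "img B (\<rho> b) \<cdot>\<^bsub>B\<^esub> h = on_arr G f \<cdot>\<^bsub>B\<^esub> img B (\<rho> a)"
    using B.kernel_lift[OF c(3,2) n] by blast
  then have "\<exists>!h. h \<in> Hom B (Dom B (img B (\<rho> a))) (Dom B (img B (\<rho> b))) \<and>
      img B (\<rho> b) \<cdot>\<^bsub>B\<^esub> h = on_arr G f \<cdot>\<^bsub>B\<^esub> img B (\<rho> a)"
    using B.mono_cancel[OF mbh(2,1)] by metis
  from theI'[OF this]
  show "on_arr (image_functor A B G \<rho>) f \<in> Hom B (Dom B (img B (\<rho> a))) (Dom B (img B (\<rho> b)))"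
    "img B (\<rho> b) \<cdot>\<^bsub>B\<^esub> on_arr (image_functor A B G \<rho>) f = on_arr G f \<cdot>\<^bsub>B\<^esub> img B (\<rho> a)"
    using F.A.HomD[OF f] by (simp_all add: image_functor_def)
qed

lemma image_functor_covariant:
  assumes B: "abelian_category B" and nat: "natural_transformation A B F G \<rho>"
  shows "covariant_functor A B (image_functor A B G \<rho>)"
proof -
  interpret B: abelian_category B by (rule B)
  interpret natural_transformation A B F G \<rho> by (rule nat)
  let ?I = "image_functor A B G \<rho>" and ?m = "\<lambda>a. img B (\<rho> a)"
  note arr = image_functor_arr[OF B nat]
  have obj: "on_obj ?I a = Dom B (?m a)" for a by (simp add: image_functor_def)
  have m: "?m a \<in> Hom B (Dom B (?m a)) (on_obj G a)" "is_mono B (?m a)" if "a \<in> Obj A" for a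
    using B.imageD[OF B.img_is_image[OF component[OF that]] component[OF that]] .
  show ?thesis
  proof unfold_locales
    fix a assume a: "a \<in> Obj A"
    show Ia: "on_obj ?I a \<in> Obj B" using B.HomD[OF m(1)[OF a]] obj by simp
    note id = F.A.idn_hom[OF a]
    have "?m a \<cdot>\<^bsub>B\<^esub> on_arr ?I (Idn A a) = ?m a \<cdot>\<^bsub>B\<^esub> Idn B (on_obj ?I a)"
      using arr(2)[OF id] G.on_idn[OF a] B.idn_comp[OF m(1)[OF a]] B.comp_idn[OF m(1)[OF a]] obj
      by simp
    then show "on_arr ?I (Idn A a) = Idn B (on_obj ?I a)"
      using B.mono_cancel[OF m(2,1)[OF a] arr(1)[OF id]] B.idn_hom[OF Ia] obj by simp
  next
    fix f a b assume "f \<in> Hom A a b"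
    then show "on_arr ?I f \<in> Hom B (on_obj ?I a) (on_obj ?I b)" using arr(1) obj by simp
  next
    fix f a b h c assume f: "f \<in> Hom A a b" and h: "h \<in> Hom A b c"
    have abc: "a \<in> Obj A" "b \<in> Obj A" "c \<in> Obj A" using F.A.HomD f h by blast+
    note hf = F.A.comp_hom[OF f h]
    have "?m c \<cdot>\<^bsub>B\<^esub> on_arr ?I (h \<cdot>\<^bsub>A\<^esub> f) = ?m c \<cdot>\<^bsub>B\<^esub> (on_arr ?I h \<cdot>\<^bsub>B\<^esub> on_arr ?I f)"
      using arr(2)[OF hf] arr(2)[OF f] arr(2)[OF h] G.on_comp[OF f h]
        B.comp_assoc[OF m(1)[OF abc(1)] G.on_arr[OF f] G.on_arr[OF h]]
        B.comp_assoc[OF arr(1)[OF f] m(1)[OF abc(2)] G.on_arr[OF h]]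
        B.comp_assoc[OF arr(1)[OF f] arr(1)[OF h] m(1)[OF abc(3)]] by simp
    then show "on_arr ?I (h \<cdot>\<^bsub>A\<^esub> f) = on_arr ?I h \<cdot>\<^bsub>B\<^esub> on_arr ?I f"
      using B.mono_cancel[OF m(2,1)[OF abc(3)] arr(1)[OF hf]
          B.comp_hom[OF arr(1)[OF f] arr(1)[OF h]]] by blast
  qed
qed

text \<open>Each \<open>\<theta>\<close> is an image of \<open>\<rho> a\<close>, hence isomorphic to the chosen one by some \<open>\<tau> a\<close>. For
  naturality, precede both sides of the square of \<open>\<tau>\<close> by \<open>\<epsilon> a\<close> and follow them by the chosen
  image of \<open>\<rho> b\<close>: by naturality of \<open>\<epsilon>\<close> they become \<open>\<rho> b \<cdot> F(f)\<close> and \<open>G(f) \<cdot> \<rho> a\<close>.\<close>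
lemma epi_mono_factorization_image_functor:
  assumes B: "abelian_category B"
    and rho: "natural_transformation A B F G \<rho>"
    and eps: "natural_transformation A B F H \<epsilon>" and epi: "\<And>a. a \<in> Obj A \<Longrightarrow> is_epi B (\<epsilon> a)"
    and theta: "\<And>a. a \<in> Obj A \<Longrightarrow>
      \<exists>\<theta> \<in> Hom B (on_obj H a) (on_obj G a). is_mono B \<theta> \<and> \<theta> \<cdot>\<^bsub>B\<^esub> \<epsilon> a = \<rho> a"
  shows "naturally_isomorphic A B H (image_functor A B G \<rho>)"
proof -
  interpret B: abelian_category B by (rule B)
  interpret R: natural_transformation A B F G \<rho> by (rule rho)
  interpret E: natural_transformation A B F H \<epsilon> by (rule eps)
  let ?I = "image_functor A B G \<rho>" and ?m = "\<lambda>a. img B (\<rho> a)"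
  interpret I: covariant_functor A B ?I by (rule image_functor_covariant[OF B rho])
  note arr = image_functor_arr[OF B rho]
  have obj: "on_obj ?I a = Dom B (?m a)" for a by (simp add: image_functor_def)
  have m: "?m a \<in> Hom B (Dom B (?m a)) (on_obj G a)" "is_mono B (?m a)" if "a \<in> Obj A" for a
    using B.imageD[OF B.img_is_image[OF R.component[OF that]] R.component[OF that]] .
  have "\<exists>t. t \<in> Hom B (on_obj H a) (Dom B (?m a)) \<and> is_iso B t \<and> ?m a \<cdot>\<^bsub>B\<^esub> (t \<cdot>\<^bsub>B\<^esub> \<epsilon> a) = \<rho> a"
    if a: "a \<in> Obj A" for a
  proof -
    note ea = E.component[OF a] and ra = R.component[OF a]
    obtain \<theta> where \<theta>: "\<theta> \<in> Hom B (on_obj H a) (on_obj G a)" "is_mono B \<theta>" "\<theta> \<cdot>\<^bsub>B\<^esub> \<epsilon> a = \<rho> a"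
      using theta[OF a] by blast
    have "is_image B (\<rho> a) \<theta>" using B.epi_mono_is_image[OF epi[OF a] ea \<theta>(2,1)] \<theta>(3) by simp
    then obtain t where "t \<in> Hom B (Dom B \<theta>) (Dom B (?m a))" "?m a \<cdot>\<^bsub>B\<^esub> t = \<theta>" "is_iso B t"
      using B.image_unique[OF _ B.img_is_image[OF ra] ra] by blast
    moreover from this have "?m a \<cdot>\<^bsub>B\<^esub> (t \<cdot>\<^bsub>B\<^esub> \<epsilon> a) = \<rho> a"
      using B.comp_assoc[OF ea _ m(1)[OF a], of t] \<theta>(3) B.HomD[OF \<theta>(1)] by simp
    ultimately show ?thesis using B.HomD[OF \<theta>(1)] by auto
  qed
  then obtain \<tau> where \<tau>: "\<And>a. a \<in> Obj A \<Longrightarrow> \<tau> a \<in> Hom B (on_obj H a) (Dom B (?m a))"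
      "\<And>a. a \<in> Obj A \<Longrightarrow> is_iso B (\<tau> a)"
      "\<And>a. a \<in> Obj A \<Longrightarrow> ?m a \<cdot>\<^bsub>B\<^esub> (\<tau> a \<cdot>\<^bsub>B\<^esub> \<epsilon> a) = \<rho> a" by metis
  have "natural_transformation A B H ?I \<tau>"
  proof unfold_locales
    fix a assume "a \<in> Obj A"
    then show "\<tau> a \<in> Hom B (on_obj H a) (on_obj ?I a)" using \<tau>(1) obj by simp
  next
    fix f a b assume f: "f \<in> Hom A a b"
    have ab: "a \<in> Obj A" "b \<in> Obj A" using R.F.A.HomD[OF f] by blast+
    note ea = E.component[OF ab(1)] and eb = E.component[OF ab(2)]
      and ta = \<tau>(1)[OF ab(1)] and tb = \<tau>(1)[OF ab(2)]
      and ma = m[OF ab(1)] and mb = m[OF ab(2)]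
      and Ff = R.F.on_arr[OF f] and Gf = R.G.on_arr[OF f] and Hf = E.G.on_arr[OF f]
      and If = arr[OF f]
    note te = B.comp_hom[OF ea ta] and te' = B.comp_hom[OF eb tb]
    have "?m b \<cdot>\<^bsub>B\<^esub> (\<tau> b \<cdot>\<^bsub>B\<^esub> on_arr H f \<cdot>\<^bsub>B\<^esub> \<epsilon> a) = \<rho> b \<cdot>\<^bsub>B\<^esub> on_arr F f"
      using B.comp_assoc[OF ea Hf tb] E.naturality[OF f] B.comp_assoc[OF Ff eb tb]
        B.comp_assoc[OF Ff te' mb(1)] \<tau>(3)[OF ab(2)] by simp
    also have "\<dots> = ?m b \<cdot>\<^bsub>B\<^esub> (on_arr ?I f \<cdot>\<^bsub>B\<^esub> \<tau> a \<cdot>\<^bsub>B\<^esub> \<epsilon> a)"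
      using R.naturality[OF f] \<tau>(3)[OF ab(1)] B.comp_assoc[OF te ma(1) Gf] If(2)
        B.comp_assoc[OF te If(1) mb(1)] B.comp_assoc[OF ea ta If(1)] by simp
    finally have "\<tau> b \<cdot>\<^bsub>B\<^esub> on_arr H f \<cdot>\<^bsub>B\<^esub> \<epsilon> a = on_arr ?I f \<cdot>\<^bsub>B\<^esub> \<tau> a \<cdot>\<^bsub>B\<^esub> \<epsilon> a"
      using B.mono_cancel[OF mb(2,1) B.comp_hom[OF ea B.comp_hom[OF Hf tb]]
          B.comp_hom[OF ea B.comp_hom[OF ta If(1)]]] by blast
    then show "\<tau> b \<cdot>\<^bsub>B\<^esub> on_arr H f = on_arr ?I f \<cdot>\<^bsub>B\<^esub> \<tau> a"
      using B.epi_cancel[OF epi[OF ab(1)] ea B.comp_hom[OF Hf tb] B.comp_hom[OF ta If(1)]] by blast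
  qed
  then show ?thesis unfolding naturally_isomorphic_def using \<tau>(2) by blast
qed

section \<open>The right cosatellite\<close>

lemma cosyzygy_choice_copresentations:
  assumes F: "abelian_functor A B F" and c: "cosyzygy_choice A i p"
  shows "injective_copresentations A B F i p"
proof -
  interpret abelian_functor A B F by (rule F)
  have c: "Dom A (i a) = a" "short_exact A (i a) (p a)" "injective_object A (Cod A (i a))"
    if "a \<in> Obj A" for a using c that unfolding cosyzygy_choice_def by blast+
  have le: "left_exact_seq A (i a) (p a)" if "a \<in> Obj A" for a
    using c(2)[OF that] unfolding short_exact_def by blast
  show ?thesis
  proof unfold_locales
    fix a b t assume a: "a \<in> Obj A" and t: "t \<in> Hom A (Cod A (i a)) (Cod A (p b))"
      "t \<cdot>\<^bsub>A\<^esub> i a = Zero A a (Cod A (p b))"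
    have ia: "i a \<in> Hom A a (Cod A (i a))" using A.left_exact_hom[OF le[OF a]] c(1)[OF a] by simp
    have "exact_at A (i a) (p a)" using le[OF a] unfolding left_exact_seq_def by blast
    then show "\<exists>s \<in> Hom A (Cod A (p a)) (Cod A (p b)). s \<cdot>\<^bsub>A\<^esub> p a = t"
      using A.exact_epi_descend[OF _ ia A.short_exact_epi[OF c(2)[OF a]] t] by blast
  qed (use c le in blast)+
qed

lemma copresentation_choice_copresentations:
  assumes F: "abelian_functor A B F" and c: "copresentation_choice A j \<delta>"
  shows "injective_copresentations A B F j \<delta>"
proof -
  interpret abelian_functor A B F by (rule F)
  have c: "Dom A (j a) = a" "left_exact_seq A (j a) (\<delta> a)"
      "injective_object A (Cod A (j a))" "injective_object A (Cod A (\<delta> a))"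
    if "a \<in> Obj A" for a using c that unfolding copresentation_choice_def by blast+
  show ?thesis
  proof unfold_locales
    fix a b t assume a: "a \<in> Obj A" and b: "b \<in> Obj A"
      and t: "t \<in> Hom A (Cod A (j a)) (Cod A (\<delta> b))" "t \<cdot>\<^bsub>A\<^esub> j a = Zero A a (Cod A (\<delta> b))"
    have ja: "j a \<in> Hom A a (Cod A (j a))"
      using A.left_exact_hom[OF c(2)[OF a]] c(1)[OF a] by simp
    have "exact_at A (j a) (\<delta> a)" using c(2)[OF a] unfolding left_exact_seq_def by blast
    then show "\<exists>s \<in> Hom A (Cod A (\<delta> a)) (Cod A (\<delta> b)). s \<cdot>\<^bsub>A\<^esub> \<delta> a = t"
      using A.exact_injective_descend[OF _ ja c(4)[OF b] t] by blast
  qed (use c in blast)+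
qed

theorem proposition5p9:
  fixes A :: "('o, 'm) preadd_cat" and B :: "('p, 'n) preadd_cat"
    and F :: "('o, 'm, 'p, 'n) cfunctor"
    and i p \<iota> \<delta> :: "'o \<Rightarrow> 'm"
  assumes "abelian_category A" and "abelian_category B"
    and "enough_injectives A"
    and "additive_functor A B F" and "half_exact A B F"
    and "cosyzygy_choice A i p"
    and "copresentation_choice A \<iota> \<delta>"
  shows "natural_transformation A B F (right_derived0 A B F \<iota> \<delta>) (rho A B F \<iota> \<delta>) \<and>
    naturally_isomorphic A B (right_cosatellite A B F i p)
      (image_functor A B (right_derived0 A B F \<iota> \<delta>) (rho A B F \<iota> \<delta>))"
proof -
  have F: "abelian_functor A B F"
    using assms(1,2,4) by (intro abelian_functor.intro)
  have P: "injective_copresentations A B F i p"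
    using cosyzygy_choice_copresentations[OF F assms(6)] .
  have Q: "injective_copresentations A B F \<iota> \<delta>"
    using copresentation_choice_copresentations[OF F assms(7)] .
  interpret P: injective_copresentations A B F i p by (rule P)
  interpret Q: injective_copresentations A B F \<iota> \<delta> by (rule Q)
  have epi: "is_epi B (rho A B F i p a)" if a: "a \<in> Obj A" for a
  proof -
    have "short_exact A (i a) (p a)" using assms(6) a unfolding cosyzygy_choice_def by blast
    then have "exact_at B (on_arr F (i a)) (on_arr F (p a))"
      using assms(5) unfolding half_exact_def by blast
    then show ?thesis by (rule P.rho_epi[OF a])
  qed
  have "naturally_isomorphic A B P.L (image_functor A B Q.L (rho A B F \<iota> \<delta>))"
  proof (rule epi_mono_factorization_image_functor[OF assms(2) Q.rho_natural P.rho_natural epi])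
    fix a assume a: "a \<in> Obj A"
    show "\<exists>\<theta> \<in> Hom B (on_obj P.L a) (on_obj Q.L a).
        is_mono B \<theta> \<and> \<theta> \<cdot>\<^bsub>B\<^esub> rho A B F i p a = rho A B F \<iota> \<delta> a"
      using rho_comparison[OF P Q a epi[OF a]] by blast
  qed
  then show ?thesis
    using Q.rho_natural unfolding right_cosatellite_def right_derived0_def by blast
qed

end
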